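(* Problem (WP1), $\max\{\sum_{t\in\mathcal T}p_t(x_t,y_t,s_t,w_t,z_t): (x,y,s,w,z)\in Q_1\}$ with convex pay-off functions $p_t$, can be solved in $O(TS^2)$ time by Algorithm 1. Hence, if the data is rational, problem (WP1) admits a pseudopolynomial time algorithm.
   Context: Let $T\ge1$, $\mathcal T=\{1,\dots,T\}$, finite nonnegative reals $L^s_t,U^s_t,L^x_t,U^x_t,L^y_t,U^y_t$ ($t\in\mathcal T$) and a given initial stock $s_0$. $Q_1$ is the set of $(x,y,s,w,z)$, $x,y,s\in\mathbb R^{\mathcal T}$, $w,z\in\{0,1\}^{\mathcal T}$, with for all $t$: $s_t=s_{t-1}-y_t+x_t$, $x_ty_t=0$, $L^s_t\le s_t\le U^s_t$, $L^y_tz_t\le y_t\le U^y_tz_t$, $L^x_tw_t\le x_t\le U^x_tw_t$. Each $p_t:\mathbb R^5\to\mathbb R$ is convex and is accessed by evaluation. For $t\in\mathcal T$ let $S_t=(A_t\cup B_t)\cap[L^s_t,U^s_t]$ where $A_t=\{K-\sum_{i=1}^t(v^1_iL^y_i+v^2_iU^y_i)+\sum_{i=1}^t(u^1_iL^x_i+u^2_iU^x_i): K\in\{s_0,U^s_1,\dots,U^s_t,L^s_1,\dots,L^s_t\},\ v^1,v^2,u^1,u^2\in\{0,1\}^t,\ v^1_i+v^2_i+u^1_i+u^2_i\le1\ \forall i\}$ and $B_t=\{K'+\sum_{i=t+1}^T(v^3_iL^y_i+v^4_iU^y_i)-\sum_{i=t+1}^T(u^3_iL^x_i+u^4_iU^x_i):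 K'\in\{U^s_{t+1},\dots,U^s_T,L^s_{t+1},\dots,L^s_T\},\ v^3,v^4,u^3,u^4\in\{0,1\}^{\{t+1,\dots,T\}},\ v^3_i+v^4_i+u^3_i+u^4_i\le1\ \forall i\}$; let $S_0=\{s_0\}$ and $S=\max_{t\in\mathcal T}|S_t|$. Algorithm 1: build a directed acyclic graph $G$ with node layers $V_0,\dots,V_T$, $V_t$ in bijection with $S_t$; for each $t$ put an arc from $s\in V_{t-1}$ to $s'\in V_t$ whenever $s'\in[s+L^x_t,s+U^x_t]\cup\{s\}\cup[s-U^y_t,s-L^y_t]$. For such an arc let $\bar x_t=(s'-s)^+$, $\bar y_t=(s-s')^+$, let $\bar W_t=\{1\}$ if $\bar x_t>0$, $\{0\}$ if $\bar x_t=0<L^x_t$, and $\{0,1\}$ otherwise, define $\bar Z_t$ analogously from $\bar y_t,L^y_t$, choose $(\bar w_t,\bar z_t)\in\arg\max_{w\in\bar W_t,z\in\bar Z_t}p_t(\bar x_t,\bar y_t,s',w,z)$ and give the arc weight $p_t(\bar x_t,\bar y_t,s',\bar w_t,\bar z_t)$. Compute a longest path from $V_0$ to $V_T$ and output the corresponding point $(x,y,s,w,z)$. "Rational data" means all bounds and $s_0$ are rational. *)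

theory Defs
  imports "HOL-Analysis.Analysis" "HOL-Library.Monad_Syntax"
begin

section \<open>The problem\<close>

text \<open>A vector indexed by \<open>{1..T}\<close> is an extensional function on \<open>nat\<close>; of the input
  sequences, which are arbitrary functions, only the values on \<open>{1..T}\<close> matter. The arguments of a
  pay-off are listed in the order \<open>(x, y, s, w, z)\<close>.\<close>

type_synonym period_point = "real \<times> real \<times> real \<times> real \<times> real"

record wp =
  horizon :: nat
  s0 :: real
  Ls :: "nat \<Rightarrow> real"
  Us :: "nat \<Rightarrow> real"
  Lx :: "nat \<Rightarrow> real"
  Ux :: "nat \<Rightarrow> real"
  Ly :: "nat \<Rightarrow> real"
  Uy :: "nat \<Rightarrow> real"
  pay :: "nat \<Rightarrow> period_point \<Rightarrow> real"

definition wp_instance :: "wp \<Rightarrow> bool" where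
  "wp_instance I \<longleftrightarrow> 1 \<le> horizon I \<and>
     (\<forall>t\<in>{1..horizon I}.
        0 \<le> Ls I t \<and> 0 \<le> Us I t \<and> 0 \<le> Lx I t \<and> 0 \<le> Ux I t \<and> 0 \<le> Ly I t \<and> 0 \<le> Uy I t \<and>
        convex_on UNIV (pay I t))"

type_synonym vec = "nat \<Rightarrow> real"
type_synonym solution = "vec \<times> vec \<times> vec \<times> vec \<times> vec"

definition Q1 :: "wp \<Rightarrow> solution set" where
  "Q1 I = {(x, y, s, w, z).
     x \<in> {1..horizon I} \<rightarrow>\<^sub>E UNIV \<and> y \<in> {1..horizon I} \<rightarrow>\<^sub>E UNIV \<and> s \<in> {1..horizon I} \<rightarrow>\<^sub>E UNIV \<and>
     w \<in> {1..horizon I} \<rightarrow>\<^sub>E {0, 1} \<and> z \<in> {1..horizon I} \<rightarrow>\<^sub>E {0, 1} \<and>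
     (\<forall>t\<in>{1..horizon I}.
        s t = (if t = 1 then s0 I else s (t - 1)) - y t + x t \<and>
        x t * y t = 0 \<and>
        Ls I t \<le> s t \<and> s t \<le> Us I t \<and>
        Ly I t * z t \<le> y t \<and> y t \<le> Uy I t * z t \<and>
        Lx I t * w t \<le> x t \<and> x t \<le> Ux I t * w t)}"

definition objective :: "wp \<Rightarrow> solution \<Rightarrow> real" where
  "objective I = (\<lambda>(x, y, s, w, z). \<Sum>t\<in>{1..horizon I}. pay I t (x t, y t, s t, w t, z t))"

definition optimal :: "wp \<Rightarrow> solution \<Rightarrow> bool" where
  "optimal I q \<longleftrightarrow> q \<in> Q1 I \<and> (\<forall>q'\<in>Q1 I. objective I q' \<le> objective I q)"

text \<open>An algorithm returns the list of the points \<open>(x\<^sub>t, y\<^sub>t, s\<^sub>t, w\<^sub>t, z\<^sub>t)\<close>,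
  \<open>t = 1, \<dots>, T\<close>, or \<open>None\<close> for an infeasible problem.\<close>

definition solution_of :: "period_point list \<Rightarrow> solution" where
  "solution_of ps =
    ((\<lambda>t\<in>{1..length ps}. case ps ! (t - 1) of (x, y, s, w, z) \<Rightarrow> x),
     (\<lambda>t\<in>{1..length ps}. case ps ! (t - 1) of (x, y, s, w, z) \<Rightarrow> y),
     (\<lambda>t\<in>{1..length ps}. case ps ! (t - 1) of (x, y, s, w, z) \<Rightarrow> s),
     (\<lambda>t\<in>{1..length ps}. case ps ! (t - 1) of (x, y, s, w, z) \<Rightarrow> w),
     (\<lambda>t\<in>{1..length ps}. case ps ! (t - 1) of (x, y, s, w, z) \<Rightarrow> z))"

definition solves :: "wp \<Rightarrow> period_point list option \<Rightarrow> bool" where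
  "solves I r \<longleftrightarrow> (case r of
      None \<Rightarrow> Q1 I = {}
    | Some ps \<Rightarrow> length ps = horizon I \<and> optimal I (solution_of ps))"


section \<open>The candidate stock levels\<close>

definition A_set :: "wp \<Rightarrow> nat \<Rightarrow> real set" where
  "A_set I t = {K - (\<Sum>i=1..t. v1 i * Ly I i + v2 i * Uy I i)
                  + (\<Sum>i=1..t. u1 i * Lx I i + u2 i * Ux I i) | K v1 v2 u1 u2.
      K \<in> {s0 I} \<union> Us I ` {1..t} \<union> Ls I ` {1..t} \<and>
      (\<forall>i\<in>{1..t}. v1 i \<in> {0, 1} \<and> v2 i \<in> {0, 1} \<and> u1 i \<in> {0, 1} \<and> u2 i \<in> {0, 1} \<and>
                   v1 i + v2 i + u1 i + u2 i \<le> 1)}"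

definition B_set :: "wp \<Rightarrow> nat \<Rightarrow> real set" where
  "B_set I t = {K + (\<Sum>i=t+1..horizon I. v3 i * Ly I i + v4 i * Uy I i)
                  - (\<Sum>i=t+1..horizon I. u3 i * Lx I i + u4 i * Ux I i) | K v3 v4 u3 u4.
      K \<in> Us I ` {t+1..horizon I} \<union> Ls I ` {t+1..horizon I} \<and>
      (\<forall>i\<in>{t+1..horizon I}. v3 i \<in> {0, 1} \<and> v4 i \<in> {0, 1} \<and> u3 i \<in> {0, 1} \<and> u4 i \<in> {0, 1} \<and>
                   v3 i + v4 i + u3 i + u4 i \<le> 1)}"

definition stock_set :: "wp \<Rightarrow> nat \<Rightarrow> real set" where
  "stock_set I t = (A_set I t \<union> B_set I t) \<inter> {Ls I t..Us I t}"

text \<open>The maximum \<open>S\<close> of the cardinalities. It is positive unless \<open>Ls\<^sub>t > Us\<^sub>t\<close> for every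
  \<open>t\<close>, in which case the problem is infeasible.\<close>

definition max_stock_card :: "wp \<Rightarrow> nat" where
  "max_stock_card I = Max ((\<lambda>t. card (stock_set I t)) ` {1..horizon I})"


section \<open>Running time\<close>

text \<open>Computations carry the number of steps they take. \<open>step e\<close> computes \<open>e\<close> in one unit of
  time. It is only applied to expressions \<open>e\<close> that, from values already computed, need a bounded
  number of reads of input entries, constructors and tests on computed Booleans, together with
  at most one real or index operation, comparison, or evaluation of a pay-off function.\<close>

datatype 'a timed = Timed (result: 'a) (time: nat)

definition step :: "'a \<Rightarrow> 'a timed" where
  "step a = Timed a 1"

definition bind_timed :: "'a timed \<Rightarrow> ('a \<Rightarrow> 'b timed) \<Rightarrow> 'b timed" where
  "bind_timed m f = Timed (result (f (result m))) (time m + time (f (result m)))"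

adhoc_overloading Monad_Syntax.bind \<rightleftharpoons> bind_timed

fun map_timed :: "('a \<Rightarrow> 'b timed) \<Rightarrow> 'a list \<Rightarrow> 'b list timed" where
  "map_timed f [] = step []"
| "map_timed f (a # as) = do {
     b \<leftarrow> f a;
     bs \<leftarrow> map_timed f as;
     step (b # bs) }"

fun append_timed :: "'a list \<Rightarrow> 'a list \<Rightarrow> 'a list timed" where
  "append_timed [] bs = step bs"
| "append_timed (a # as) bs = do {
     cs \<leftarrow> append_timed as bs;
     step (a # cs) }"

fun concat_timed :: "'a list list \<Rightarrow> 'a list timed" where
  "concat_timed [] = step []"
| "concat_timed (as # ass) = do {
     bs \<leftarrow> concat_timed ass;
     append_timed as bs }"

definition product_timed :: "('a \<Rightarrow> 'b \<Rightarrow> 'c timed) \<Rightarrow> 'a list \<Rightarrow> 'b list \<Rightarrow> 'c list timed" where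
  "product_timed f as bs = do {
     css \<leftarrow> map_timed (\<lambda>a. map_timed (f a) bs) as;
     concat_timed css }"

fun rev_timed :: "'a list \<Rightarrow> 'a list \<Rightarrow> 'a list timed" where
  "rev_timed [] acc = step acc"
| "rev_timed (a # as) acc = do {
     acc' \<leftarrow> step (a # acc);
     rev_timed as acc' }"

fun catSome_timed :: "'a option list \<Rightarrow> 'a list timed" where
  "catSome_timed [] = step []"
| "catSome_timed (r # rs) = do {
     as \<leftarrow> catSome_timed rs;
     step (case r of None \<Rightarrow> as | Some a \<Rightarrow> a # as) }"

text \<open>An entry with the largest first component.\<close>

fun best_timed :: "(real \<times> 'a) list \<Rightarrow> (real \<times> 'a) option timed" where
  "best_timed [] = step None"
| "best_timed ((v, a) # rs) = do {
     m \<leftarrow> best_timed rs;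
     (case m of
        None \<Rightarrow> step (Some (v, a))
      | Some (v', a') \<Rightarrow> do {
          b \<leftarrow> step (v' \<le> v);
          step (if b then Some (v, a) else Some (v', a')) }) }"


section \<open>The algorithm on the layered graph\<close>

definition arc_test :: "wp \<Rightarrow> nat \<Rightarrow> real \<Rightarrow> real \<Rightarrow> bool timed" where
  "arc_test I t s s' = do {
     xl \<leftarrow> step (s + Lx I t);
     xu \<leftarrow> step (s + Ux I t);
     yl \<leftarrow> step (s - Uy I t);
     yu \<leftarrow> step (s - Ly I t);
     b1 \<leftarrow> step (xl \<le> s');
     b2 \<leftarrow> step (s' \<le> xu);
     b3 \<leftarrow> step (s' = s);
     b4 \<leftarrow> step (yl \<le> s');
     b5 \<leftarrow> step (s' \<le> yu);
     step ((b1 \<and> b2) \<or> b3 \<or> (b4 \<and> b5)) }"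

definition pos_part_diff :: "real \<Rightarrow> real \<Rightarrow> real timed" where
  "pos_part_diff a b = do {
     d \<leftarrow> step (a - b);
     step (max d 0) }"

text \<open>The set \<open>\<bar>W\<^sub>t\<close> (or \<open>\<bar>Z\<^sub>t\<close>) of admissible switch values for a flow
  \<open>f \<ge> 0\<close> with lower bound \<open>l\<close>.\<close>

definition switches :: "real \<Rightarrow> real \<Rightarrow> real list timed" where
  "switches f l = do {
     b \<leftarrow> step (0 < f);
     if b then step [1]
     else do {
       c \<leftarrow> step (0 < l);
       step (if c then [0] else [0, 1]) } }"

text \<open>The arc from \<open>s\<close> in layer \<open>t - 1\<close> to \<open>s'\<close> in layer \<open>t\<close>, if there is one: its weight,
  and the point of period \<open>t\<close> it stands for.\<close>

definition make_arc :: "wp \<Rightarrow> nat \<Rightarrow> real \<Rightarrow> real \<Rightarrow> (real \<times> period_point) option timed" where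
  "make_arc I t s s' = do {
     b \<leftarrow> arc_test I t s s';
     if \<not> b then step None
     else do {
       x \<leftarrow> pos_part_diff s' s;
       y \<leftarrow> pos_part_diff s s';
       W \<leftarrow> switches x (Lx I t);
       Z \<leftarrow> switches y (Ly I t);
       cands \<leftarrow> product_timed (\<lambda>w z. step (pay I t (x, y, s', w, z), (x, y, s', w, z))) W Z;
       best_timed cands } }"

text \<open>The graph is a list of adjacency matrices, one for each pair of consecutive layers; the rows
  belong to the heads and the columns to the tails of the arcs. In \<open>build_graph I t V Vs\<close> the
  list \<open>V\<close> is layer \<open>t - 1\<close> and \<open>Vs\<close> are the layers from \<open>t\<close> on.\<close>

type_synonym arc_matrix = "(real \<times> period_point) option list list"

fun build_graph :: "wp \<Rightarrow> nat \<Rightarrow> real list \<Rightarrow> real list list \<Rightarrow> arc_matrix list timed" where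
  "build_graph I t V [] = step []"
| "build_graph I t V (V' # Vs) = do {
     M \<leftarrow> map_timed (\<lambda>s'. map_timed (\<lambda>s. make_arc I t s s') V) V';
     t' \<leftarrow> step (Suc t);
     Ms \<leftarrow> build_graph I t' V' Vs;
     step (M # Ms) }"

text \<open>The label of a node is the length of a longest path from layer 0 to it together with such a
  path, last arc first; it is \<open>None\<close> for unreachable nodes.\<close>

type_synonym label = "(real \<times> period_point list) option"

definition extend_label :: "label \<Rightarrow> (real \<times> period_point) option \<Rightarrow> label timed" where
  "extend_label lb a = (case (lb, a) of
      (Some (v, qs), Some (c, q)) \<Rightarrow> do {
        v' \<leftarrow> step (v + c);
        step (Some (v', q # qs)) }
    | _ \<Rightarrow> step None)"

fun extend_labels :: "label list \<Rightarrow> (real \<times> period_point) option list \<Rightarrow> label list timed" where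
  "extend_labels (lb # lbs) (a # as) = do {
     lb' \<leftarrow> extend_label lb a;
     lbs' \<leftarrow> extend_labels lbs as;
     step (lb' # lbs') }"
| "extend_labels _ _ = step []"

definition best_label :: "label list \<Rightarrow> label timed" where
  "best_label lbs = do {
     cands \<leftarrow> catSome_timed lbs;
     best_timed cands }"

fun longest_path :: "label list \<Rightarrow> arc_matrix list \<Rightarrow> label timed" where
  "longest_path lbs [] = best_label lbs"
| "longest_path lbs (M # Ms) = do {
     lbs' \<leftarrow> map_timed (\<lambda>row. do {
               cands \<leftarrow> extend_labels lbs row;
               best_label cands }) M;
     longest_path lbs' Ms }"

text \<open>The argument \<open>Vs\<close> lists the layers \<open>1, \<dots>, T\<close>.\<close>

definition algorithm1 :: "wp \<Rightarrow> real list list \<Rightarrow> period_point list option timed" where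
  "algorithm1 I Vs = do {
     G \<leftarrow> build_graph I 1 [s0 I] Vs;
     lb \<leftarrow> longest_path [Some (0, [])] G;
     (case lb of
        None \<Rightarrow> step None
      | Some (v, qs) \<Rightarrow> do {
          ps \<leftarrow> rev_timed qs [];
          step (Some ps) }) }"

definition node_layers :: "wp \<Rightarrow> real list list \<Rightarrow> bool" where
  "node_layers I Vs \<longleftrightarrow> length Vs = horizon I \<and>
     (\<forall>t\<in>{1..horizon I}. distinct (Vs ! (t - 1)) \<and> set (Vs ! (t - 1)) = stock_set I t)"


section \<open>Computing the layers\<close>

fun member_timed :: "real \<Rightarrow> real list \<Rightarrow> bool timed" where
  "member_timed a [] = step False"
| "member_timed a (b # bs) = do {
     e \<leftarrow> step (a = b);
     if e then step True else member_timed a bs }"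

fun remdups_timed :: "real list \<Rightarrow> real list timed" where
  "remdups_timed [] = step []"
| "remdups_timed (a # as) = do {
     bs \<leftarrow> remdups_timed as;
     e \<leftarrow> member_timed a bs;
     step (if e then bs else a # bs) }"

fun clip_timed :: "real \<Rightarrow> real \<Rightarrow> real list \<Rightarrow> real list timed" where
  "clip_timed l u [] = step []"
| "clip_timed l u (a # as) = do {
     bs \<leftarrow> clip_timed l u as;
     b1 \<leftarrow> step (l \<le> a);
     b2 \<leftarrow> step (a \<le> u);
     step (if b1 \<and> b2 then a # bs else bs) }"

text \<open>The result is \<open>[i..<i + n]\<close>.\<close>

fun range_timed :: "nat \<Rightarrow> nat \<Rightarrow> nat list timed" where
  "range_timed i 0 = step []"
| "range_timed i (Suc n) = do {
     j \<leftarrow> step (Suc i);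
     is \<leftarrow> range_timed j n;
     step (i # is) }"

text \<open>All distinct sums \<open>\<Sum>i. u\<^sub>i Lx\<^sub>i + u'\<^sub>i Ux\<^sub>i - v\<^sub>i Ly\<^sub>i - v'\<^sub>i Uy\<^sub>i\<close> over the given periods
  \<open>i\<close>, for 0/1 coefficients of which at most one is nonzero in each period.\<close>

fun flow_sums :: "wp \<Rightarrow> nat list \<Rightarrow> real list timed" where
  "flow_sums I [] = step [0]"
| "flow_sums I (i # is) = do {
     ps \<leftarrow> flow_sums I is;
     a \<leftarrow> step (- Ly I i);
     b \<leftarrow> step (- Uy I i);
     ms \<leftarrow> step [0, a, b, Lx I i, Ux I i];
     qs \<leftarrow> product_timed (\<lambda>p m. step (p + m)) ps ms;
     remdups_timed qs }"

fun stock_bounds :: "wp \<Rightarrow> nat list \<Rightarrow> real list timed" where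
  "stock_bounds I [] = step []"
| "stock_bounds I (i # is) = do {
     ks \<leftarrow> stock_bounds I is;
     step (Us I i # Ls I i # ks) }"

definition make_layer :: "wp \<Rightarrow> nat \<Rightarrow> real list timed" where
  "make_layer I t = do {
     earlier \<leftarrow> range_timed 1 t;
     ks \<leftarrow> stock_bounds I earlier;
     ps \<leftarrow> flow_sums I earlier;
     as \<leftarrow> product_timed (\<lambda>k p. step (k + p)) (s0 I # ks) ps;
     n \<leftarrow> step (horizon I - t);
     t' \<leftarrow> step (Suc t);
     later \<leftarrow> range_timed t' n;
     ks' \<leftarrow> stock_bounds I later;
     ps' \<leftarrow> flow_sums I later;
     bs \<leftarrow> product_timed (\<lambda>k p. step (k - p)) ks' ps';
     cs \<leftarrow> append_timed as bs;
     ds \<leftarrow> clip_timed (Ls I t) (Us I t) cs;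
     remdups_timed ds }"

definition solve_wp :: "wp \<Rightarrow> period_point list option timed" where
  "solve_wp I = do {
     ts \<leftarrow> range_timed 1 (horizon I);
     Vs \<leftarrow> map_timed (make_layer I) ts;
     algorithm1 I Vs }"


section \<open>Rational data\<close>

definition data :: "wp \<Rightarrow> real set" where
  "data I = {s0 I} \<union> (\<Union>t\<in>{1..horizon I}. {Ls I t, Us I t, Lx I t, Ux I t, Ly I t, Uy I t})"

text \<open>Rational data are encoded as integers over their least common denominator. The magnitude
  that enters a pseudopolynomial time bound is the largest absolute value of these integers.\<close>

definition common_denominator :: "wp \<Rightarrow> nat" where
  "common_denominator I = (LEAST d. 0 < d \<and> (\<forall>r\<in>data I. real d * r \<in> \<int>))"

definition max_number :: "wp \<Rightarrow> real" where
  "max_number I = Max ((\<lambda>r. \<bar>real (common_denominator I) * r\<bar>) ` data I)"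

end

theory Submission
  imports Defs
begin

text \<open>Fix the switches of a feasible point and, in each period, which of the two flows vanishes.
  The stock vectors that remain form a polytope given by bounds on the stocks and on the differences
  of consecutive stocks, on which the objective is convex. If a stock is not joined by tight difference
  constraints to \<open>s\<^sub>0\<close> or to a stock at its bound, the stocks joined to it can be shifted
  simultaneously, both up and down, until a further constraint becomes tight; by convexity one of the
  two shifts does not decrease the objective. A point with the most tight constraints therefore has
  all its stocks in the candidate sets, that is, it is a path of the layered graph. For rational data
  with common denominator \<open>D\<close> and magnitude \<open>M\<close>, all partial sums of flows are multiples of
  \<open>1 / D\<close> of absolute value at most \<open>T M / D\<close>, so that there are at most \<open>2 T M + 1\<close> of them.\<close>

section \<open>Timed list operations\<close>

text \<open>Existence of an optimum is a result, not an assumption: each feasible point is dominated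
  by a walk through candidate stocks, and the final label dominates each such walk. Hence
  \<open>None\<close> means infeasibility, and otherwise the returned path, itself feasible, is
  optimal. Shifting stocks is compatible with convexity because one flow per period is frozen at 0:
  both flows are then affine in the stocks, and no positive part of a stock difference enters the
  objective. The switches kept during the shift need not be those chosen by the arcs, but an arc
  takes the best admissible ones and can only gain. In the pseudopolynomial part, removing
  duplicates after every period prevents lists of \<open>5 ^ T\<close> sums. With
  \<open>X = T * (2 * T * M + 1)\<close>, a layer has O(X) nodes and takes O(X^2) steps, so the
  total is O(T X^2), at most O(X^3). As X is at most \<open>3 * (T + M) ^ 3\<close>, the exponent is
  9.\<close>

lemma result_step [simp]: "result (step a) = a"
  and time_step [simp]: "time (step a) = 1"
  by (simp_all add: step_def)

lemma result_bind [simp]: "result (bind_timed m f) = result (f (result m))"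
  and time_bind [simp]: "time (bind_timed m f) = time m + time (f (result m))"
  by (simp_all add: bind_timed_def)

lemma result_map_timed [simp]: "result (map_timed f as) = map (\<lambda>a. result (f a)) as"
  by (induction as) auto

lemma time_map_timed:
  assumes "\<And>a. a \<in> set as \<Longrightarrow> time (f a) \<le> c"
  shows "time (map_timed f as) \<le> length as * (c + 1) + 1"
  using assms
proof (induction as)
  case (Cons a as)
  then have "time (f a) \<le> c" "time (map_timed f as) \<le> length as * (c + 1) + 1"
    by simp_all
  then show ?case by simp
qed simp

lemma result_append_timed [simp]: "result (append_timed as bs) = as @ bs"
  and time_append_timed [simp]: "time (append_timed as bs) = length as + 1"
  by (induction as) auto

lemma result_concat_timed [simp]: "result (concat_timed ass) = concat ass"
  by (induction ass) auto

lemma time_concat_timed: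
  assumes "\<And>as. as \<in> set ass \<Longrightarrow> length as \<le> n"
  shows "time (concat_timed ass) \<le> length ass * (n + 1) + 1"
  using assms
proof (induction ass)
  case (Cons as ass)
  then have "length as \<le> n" "time (concat_timed ass) \<le> length ass * (n + 1) + 1"
    by simp_all
  then show ?case by simp
qed simp

lemma result_product_timed [simp]:
  "result (product_timed f as bs) = concat (map (\<lambda>a. map (\<lambda>b. result (f a b)) bs) as)"
  by (simp add: product_timed_def)

lemma time_product_timed:
  assumes "\<And>a b. time (f a b) = 1"
  shows "time (product_timed f as bs) \<le> length as * (3 * length bs + 3) + 2"
proof -
  have "time (map_timed (f a) bs) \<le> 2 * length bs + 1" for a
    using time_map_timed[of bs "f a" 1] assms by simp
  then have "time (map_timed (\<lambda>a. map_timed (f a) bs) as) \<le> length as * (2 * length bs + 2) + 1"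
    using time_map_timed[of as "\<lambda>a. map_timed (f a) bs" "2 * length bs + 1"] by simp
  moreover have "time (concat_timed (map (\<lambda>a. map (\<lambda>b. result (f a b)) bs) as))
      \<le> length as * (length bs + 1) + 1"
    by (rule order_trans[OF time_concat_timed[of _ "length bs"]]) auto
  ultimately show ?thesis
    by (simp add: product_timed_def algebra_simps)
qed

lemma length_concat_map_const:
  "length (concat (map (\<lambda>a. map (g a) bs) as)) = length as * length bs"
  by (induction as) auto

lemma result_rev_timed [simp]: "result (rev_timed as acc) = rev as @ acc"
  and time_rev_timed [simp]: "time (rev_timed as acc) = length as + 1"
  by (induction as arbitrary: acc) simp_all

lemma set_catSome_timed: "a \<in> set (result (catSome_timed rs)) \<longleftrightarrow> Some a \<in> set rs"
  by (induction rs) (auto split: option.splits)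

lemma length_catSome_timed: "length (result (catSome_timed rs)) \<le> length rs"
  by (induction rs) (auto split: option.splits)

lemma time_catSome_timed [simp]: "time (catSome_timed rs) = length rs + 1"
  by (induction rs) (auto split: option.splits)

lemma time_best_timed: "time (best_timed rs) \<le> 3 * length rs + 1"
proof (induction rs)
  case (Cons r rs)
  then show ?case by (cases r) (auto split: option.splits)
qed simp

lemma best_timed_Some:
  "result (best_timed rs) = Some r \<Longrightarrow> r \<in> set rs"
proof (induction rs)
  case (Cons r' rs)
  then show ?case by (cases r') (auto split: option.splits if_splits)
qed simp

lemma best_timed_ge:
  "(v, a) \<in> set rs \<Longrightarrow> \<exists>v' a'. result (best_timed rs) = Some (v', a') \<and> v \<le> v'"
proof (induction rs)
  case (Cons r rs)
  show ?case
  proof (cases r)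
    case r: (Pair v1 a1)
    show ?thesis
    proof (cases "(v, a) \<in> set rs")
      case True
      then obtain v' a' where "result (best_timed rs) = Some (v', a')" "v \<le> v'"
        using Cons by blast
      then show ?thesis using r by auto
    next
      case False
      then show ?thesis using Cons.prems r by (cases "result (best_timed rs)") auto
    qed
  qed
qed simp

lemma best_label_Some: "result (best_label lbs) = Some r \<Longrightarrow> Some r \<in> set lbs"
  by (auto simp: best_label_def set_catSome_timed dest: best_timed_Some)

lemma best_label_ge:
  "Some (v, a) \<in> set lbs \<Longrightarrow> \<exists>v' a'. result (best_label lbs) = Some (v', a') \<and> v \<le> v'"
  using best_timed_ge[of v a "result (catSome_timed lbs)"]
  by (simp add: best_label_def set_catSome_timed)

lemma time_best_label: "time (best_label lbs) \<le> 4 * length lbs + 2"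
  using time_best_timed[of "result (catSome_timed lbs)"] length_catSome_timed[of lbs]
  by (simp add: best_label_def)


section \<open>Walks in the layered graph\<close>

abbreviation stock :: "period_point \<Rightarrow> real" where
  "stock q \<equiv> fst (snd (snd q))"

text \<open>The constraints of \<open>Q1\<close> for a single period, except the bounds on the
  stock: those are imposed by the layers, whose nodes lie between \<open>Ls I t\<close> and
  \<open>Us I t\<close>.\<close>

definition transition :: "wp \<Rightarrow> nat \<Rightarrow> real \<Rightarrow> period_point \<Rightarrow> bool" where
  "transition I t s = (\<lambda>(x, y, s', w, z). s' = s - y + x \<and> x * y = 0 \<and> w \<in> {0, 1} \<and> z \<in> {0, 1} \<and>
     Ly I t * z \<le> y \<and> y \<le> Uy I t * z \<and> Lx I t * w \<le> x \<and> x \<le> Ux I t * w)"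

text \<open>The part of \<open>wp_instance\<close> that arcs depend on, split off per period so that
  inductions over the layers can start at any period.\<close>

definition nonneg_bounds :: "wp \<Rightarrow> nat \<Rightarrow> bool" where
  "nonneg_bounds I t \<longleftrightarrow> 0 \<le> Lx I t \<and> 0 \<le> Ux I t \<and> 0 \<le> Ly I t \<and> 0 \<le> Uy I t"

lemma wp_instance_nonneg_bounds:
  "wp_instance I \<Longrightarrow> t \<in> {1..horizon I} \<Longrightarrow> nonneg_bounds I t"
  by (simp add: wp_instance_def nonneg_bounds_def)

lemma result_arc_test [simp]: "result (arc_test I t s s') \<longleftrightarrow>
    (s + Lx I t \<le> s' \<and> s' \<le> s + Ux I t) \<or> s' = s \<or> (s - Uy I t \<le> s' \<and> s' \<le> s - Ly I t)"
  by (simp add: arc_test_def)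

lemma result_switches [simp]: "result (switches f l) = (if 0 < f then [1] else if 0 < l then [0] else [0, 1])"
  and time_switches: "time (switches f l) \<le> 3"
  and length_switches: "length (result (switches f l)) \<le> 2"
  by (simp_all add: switches_def)

lemma result_pos_part_diff [simp]: "result (pos_part_diff a b) = max (a - b) 0"
  by (simp add: pos_part_diff_def)

text \<open>As the bounds are nonnegative, only the first disjunct of the arc test can hold if
  \<open>s' > s\<close>, and only the last if \<open>s' < s\<close>; this gives the flow bounds for
  switch 1. A zero flow always allows switch 0, and it allows switch 1 if its lower bound is
  0.\<close>

lemma make_arc_sound:
  assumes "nonneg_bounds I t" "result (make_arc I t s s') = Some (c, q)"
  shows "c = pay I t q" "stock q = s'" "transition I t s q"
proof -
  let ?x = "max (s' - s) 0" and ?y = "max (s - s') 0"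
  let ?W = "result (switches ?x (Lx I t))" and ?Z = "result (switches ?y (Ly I t))"
  have arc: "result (arc_test I t s s')"
    using assms(2) by (auto simp: make_arc_def simp del: result_arc_test split: if_splits)
  then have "(c, q) \<in> set (concat (map (\<lambda>w. map (\<lambda>z.
      (pay I t (?x, ?y, s', w, z), (?x, ?y, s', w, z))) ?Z) ?W))"
    using assms(2) best_timed_Some by (fastforce simp: make_arc_def simp del: result_arc_test result_switches)
  then obtain w z where wz: "w \<in> set ?W" "z \<in> set ?Z"
    and q: "q = (?x, ?y, s', w, z)" and c: "c = pay I t q"
    by auto
  show "c = pay I t q" "stock q = s'" using c q by auto
  show "transition I t s q"
    using assms(1) arc wz unfolding q transition_def nonneg_bounds_def
    by (auto simp: max_def split: if_splits)
qed

text \<open>The flows can be recovered from the stocks: complementarity and nonnegativity force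
  \<open>x = max (s' - s) 0\<close> and \<open>y = max (s - s') 0\<close>. Only the switches of
  \<open>q'\<close> may differ from those of \<open>q\<close>, hence the inequality.\<close>

lemma make_arc_complete:
  assumes "nonneg_bounds I t" "transition I t s q"
  shows "\<exists>c q'. result (make_arc I t s (stock q)) = Some (c, q') \<and> pay I t q \<le> c"
proof -
  obtain x y s' w z where q: "q = (x, y, s', w, z)" by (metis prod_cases5)
  have tr: "s' = s - y + x" "x * y = 0" "w \<in> {0, 1}" "z \<in> {0, 1}"
    "Ly I t * z \<le> y" "y \<le> Uy I t * z" "Lx I t * w \<le> x" "x \<le> Ux I t * w"
    using assms(2) by (simp_all add: transition_def q)
  have nn: "0 \<le> x" "0 \<le> y"
    using tr assms(1) by (auto simp: nonneg_bounds_def)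
  have xy: "x = max (s' - s) 0" "y = max (s - s') 0"
    using tr(1,2) nn by auto
  have arc: "result (arc_test I t s s')"
    using tr assms(1) nn by (auto simp: nonneg_bounds_def)
  have wz: "w \<in> set (result (switches x (Lx I t)))" "z \<in> set (result (switches y (Ly I t)))"
    using tr nn by auto
  let ?cands = "concat (map (\<lambda>w. map (\<lambda>z. (pay I t (x, y, s', w, z), (x, y, s', w, z)))
     (result (switches y (Ly I t)))) (result (switches x (Lx I t))))"
  have "(pay I t q, q) \<in> set ?cands"
    using wz by (force simp: q simp del: result_switches)
  from best_timed_ge[OF this] obtain c q'
    where "result (best_timed ?cands) = Some (c, q')" "pay I t q \<le> c"
    by (elim exE conjE)
  moreover have "result (make_arc I t s s') = result (best_timed ?cands)"
    using arc by (simp add: make_arc_def xy[symmetric] del: result_arc_test result_switches)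
  ultimately have "result (make_arc I t s (stock q)) = Some (c, q')" "pay I t q \<le> c"
    by (simp_all add: q)
  then show ?thesis by blast
qed

text \<open>Each switch has at most two values, so at most four candidates are evaluated; the counts
  add up to 10 + 4 + 6 + 20 + 13 = 53.\<close>

lemma time_make_arc: "time (make_arc I t s s') \<le> 60"
proof -
  have arc: "time (arc_test I t s s') = 10" by (simp add: arc_test_def)
  let ?x = "max (s' - s) 0" and ?y = "max (s - s') 0"
  let ?W = "result (switches ?x (Lx I t))" and ?Z = "result (switches ?y (Ly I t))"
  let ?f = "\<lambda>w z. (pay I t (?x, ?y, s', w, z), (?x, ?y, s', w, z))"
  let ?cands = "concat (map (\<lambda>w. map (?f w) ?Z) ?W)"
  have len: "length ?W \<le> 2" "length ?Z \<le> 2" by (rule length_switches)+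
  have "time (product_timed (\<lambda>w z. step (?f w z)) ?W ?Z) \<le> length ?W * (3 * length ?Z + 3) + 2"
    by (rule time_product_timed) simp
  also have "\<dots> \<le> 2 * (3 * 2 + 3) + 2"
    using len by (intro add_mono mult_mono) auto
  finally have p: "time (product_timed (\<lambda>w z. step (?f w z)) ?W ?Z) \<le> 20" by simp
  have "length ?cands = length ?W * length ?Z" by (rule length_concat_map_const)
  also have "\<dots> \<le> 2 * 2" using len by (rule mult_mono) auto
  finally have b: "time (best_timed ?cands) \<le> 13"
    using time_best_timed[of ?cands] by linarith
  show ?thesis
    using arc p b time_switches[of ?x "Lx I t"] time_switches[of ?y "Ly I t"]
    by (simp add: make_arc_def pos_part_diff_def del: result_arc_test result_switches)
qed

section \<open>Longest-path labels versus walks\<close>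

fun walk :: "wp \<Rightarrow> nat \<Rightarrow> real \<Rightarrow> period_point list \<Rightarrow> bool" where
  "walk I t s [] \<longleftrightarrow> True"
| "walk I t s (q # qs) \<longleftrightarrow> transition I t s q \<and> walk I (Suc t) (stock q) qs"

fun payoff :: "wp \<Rightarrow> nat \<Rightarrow> period_point list \<Rightarrow> real" where
  "payoff I t [] = 0"
| "payoff I t (q # qs) = pay I t q + payoff I (Suc t) qs"

lemma extend_label_Some:
  "result (extend_label lb a) = Some r \<longleftrightarrow>
    (\<exists>v qs c q. lb = Some (v, qs) \<and> a = Some (c, q) \<and> r = (v + c, q # qs))"
  by (auto simp: extend_label_def split: option.splits)

lemma length_extend_labels:
  "length lbs = length as \<Longrightarrow> length (result (extend_labels lbs as)) = length as"
  by (induction lbs as rule: list_induct2) auto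

lemma nth_extend_labels:
  "length lbs = length as \<Longrightarrow> j < length as \<Longrightarrow>
    result (extend_labels lbs as) ! j = result (extend_label (lbs ! j) (as ! j))"
proof (induction lbs as arbitrary: j rule: list_induct2)
  case (Cons lb lbs a as)
  then show ?case by (cases j) auto
qed simp

text \<open>The initial labels are arbitrary, so that the induction can absorb one matrix into them:
  \<open>?lbs'\<close> are the initial labels of the remaining graph. Labels store the last arc
  first, hence \<open>rev ps\<close>.\<close>

lemma longest_path_sound:
  assumes "\<And>i. i < length Vs \<Longrightarrow> nonneg_bounds I (t + i)" "length lbs = length V"
    and "result (longest_path lbs (result (build_graph I t V Vs))) = Some (v, qs)"
  shows "\<exists>j v0 qs0 ps. j < length V \<and> lbs ! j = Some (v0, qs0) \<and> qs = rev ps @ qs0 \<and>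
     walk I t (V ! j) ps \<and> list_all2 (\<lambda>q V. stock q \<in> set V) ps Vs \<and> v = v0 + payoff I t ps"
  using assms
proof (induction Vs arbitrary: t lbs V)
  case Nil
  then have "Some (v, qs) \<in> set lbs" by (auto dest: best_label_Some)
  then obtain j where "j < length lbs" "lbs ! j = Some (v, qs)" by (metis in_set_conv_nth)
  then show ?case using Nil.prems(2) by force
next
  case (Cons V' Vs)
  let ?row = "\<lambda>s'. map (\<lambda>s. result (make_arc I t s s')) V"
  let ?lbs' = "map (\<lambda>s'. result (best_label (result (extend_labels lbs (?row s'))))) V'"
  have nn: "nonneg_bounds I (Suc t + i)" if "i < length Vs" for i
    using Cons.prems(1)[of "Suc i"] that by simp
  have "result (longest_path ?lbs' (result (build_graph I (Suc t) V' Vs))) = Some (v, qs)"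
    using Cons.prems(3) by (simp add: comp_def)
  from Cons.IH[OF nn _ this] obtain j v0 qs0 ps where j: "j < length V'"
    "?lbs' ! j = Some (v0, qs0)" "qs = rev ps @ qs0" "walk I (Suc t) (V' ! j) ps"
    "list_all2 (\<lambda>q V. stock q \<in> set V) ps Vs" "v = v0 + payoff I (Suc t) ps"
    by auto
  have "Some (v0, qs0) \<in> set (result (extend_labels lbs (?row (V' ! j))))"
    using j(1,2) by (auto dest: best_label_Some)
  then obtain i where i: "i < length V"
    "result (extend_label (lbs ! i) (result (make_arc I t (V ! i) (V' ! j)))) = Some (v0, qs0)"
    using Cons.prems(2) by (auto simp: in_set_conv_nth length_extend_labels nth_extend_labels)
  then obtain v1 qs1 c q where lb: "lbs ! i = Some (v1, qs1)"
    and arc: "result (make_arc I t (V ! i) (V' ! j)) = Some (c, q)"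
    and r: "v0 = v1 + c" "qs0 = q # qs1"
    by (auto simp: extend_label_Some)
  have "nonneg_bounds I t" using Cons.prems(1)[of 0] by simp
  note q = make_arc_sound[OF this arc]
  have "qs = rev (q # ps) @ qs1" "walk I t (V ! i) (q # ps)"
    "list_all2 (\<lambda>q V. stock q \<in> set V) (q # ps) (V' # Vs)" "v = v1 + payoff I t (q # ps)"
    using j r q by auto
  with i(1) lb show ?case by blast
qed

text \<open>Dynamic programming: the new label of a head is at least the old label of any tail plus
  the weight of the arc. Following the given walk, labels can only gain on it, since arcs may pick
  better switches and nodes better predecessors.\<close>

lemma longest_path_complete:
  assumes "\<And>i. i < length Vs \<Longrightarrow> nonneg_bounds I (t + i)" "length lbs = length V"
    and "j < length V" "lbs ! j = Some (v0, qs0)" "walk I t (V ! j) ps"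
    and "list_all2 (\<lambda>q V. stock q \<in> set V) ps Vs"
  shows "\<exists>v qs. result (longest_path lbs (result (build_graph I t V Vs))) = Some (v, qs) \<and>
     v0 + payoff I t ps \<le> v"
  using assms
proof (induction Vs arbitrary: t lbs V j v0 qs0 ps)
  case Nil
  then have "Some (v0, qs0) \<in> set lbs" by (metis nth_mem)
  then show ?case using best_label_ge Nil.prems(6) by fastforce
next
  case (Cons V' Vs)
  let ?row = "\<lambda>s'. map (\<lambda>s. result (make_arc I t s s')) V"
  let ?lbs' = "map (\<lambda>s'. result (best_label (result (extend_labels lbs (?row s'))))) V'"
  have nn: "nonneg_bounds I (Suc t + i)" if "i < length Vs" for i
    using Cons.prems(1)[of "Suc i"] that by simp
  obtain q ps' where ps: "ps = q # ps'" "stock q \<in> set V'"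
    "list_all2 (\<lambda>q V. stock q \<in> set V) ps' Vs"
    using Cons.prems(6) by (auto simp: list_all2_Cons2)
  then obtain i where i: "i < length V'" "V' ! i = stock q" by (metis in_set_conv_nth)
  have tr: "transition I t (V ! j) q" "walk I (Suc t) (V' ! i) ps'"
    using Cons.prems(5) ps i by auto
  have "nonneg_bounds I t" using Cons.prems(1)[of 0] by simp
  then obtain c q' where arc: "result (make_arc I t (V ! j) (stock q)) = Some (c, q')"
    "pay I t q \<le> c"
    using make_arc_complete tr(1) by blast
  have "result (extend_labels lbs (?row (stock q))) ! j = Some (v0 + c, q' # qs0)"
    using Cons.prems(2-4) arc by (simp add: nth_extend_labels extend_label_Some)
  moreover have "j < length (result (extend_labels lbs (?row (stock q))))"
    using Cons.prems(2,3) by (simp add: length_extend_labels)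
  ultimately have "Some (v0 + c, q' # qs0) \<in> set (result (extend_labels lbs (?row (stock q))))"
    by (metis nth_mem)
  from best_label_ge[OF this] obtain v1 qs1 where lb: "?lbs' ! i = Some (v1, qs1)" "v0 + c \<le> v1"
    using i by auto
  obtain v qs where
    "result (longest_path ?lbs' (result (build_graph I (Suc t) V' Vs))) = Some (v, qs)"
    "v1 + payoff I (Suc t) ps' \<le> v"
    using Cons.IH[OF nn _ i(1) lb(1) tr(2) ps(3)] by auto
  moreover have "v0 + payoff I t ps \<le> v1 + payoff I (Suc t) ps'"
    using lb(2) arc(2) ps(1) by simp
  ultimately show ?case by (simp add: comp_def)
qed

section \<open>Operation counts for the graph phase\<close>

lemma time_build_graph:
  assumes "length V \<le> n" "\<And>V'. V' \<in> set Vs \<Longrightarrow> length V' \<le> n"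
  shows "time (build_graph I t V Vs) \<le> length Vs * (61 * n\<^sup>2 + 2 * n + 3) + 1"
  using assms
proof (induction Vs arbitrary: t V)
  case (Cons V' Vs)
  have "time (map_timed (\<lambda>s. make_arc I t s s') V) \<le> 61 * n + 1" for s'
    using time_map_timed[of V "\<lambda>s. make_arc I t s s'" 60] time_make_arc Cons.prems(1) by fastforce
  then have "time (map_timed (\<lambda>s'. map_timed (\<lambda>s. make_arc I t s s') V) V')
      \<le> length V' * (61 * n + 1 + 1) + 1"
    by (intro time_map_timed)
  also have "\<dots> \<le> n * (61 * n + 1 + 1) + 1"
    using Cons.prems(2) by (intro add_mono mult_mono) auto
  finally have "time (map_timed (\<lambda>s'. map_timed (\<lambda>s. make_arc I t s s') V) V')
      \<le> 61 * n\<^sup>2 + 2 * n + 1"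
    by (simp add: power2_eq_square algebra_simps)
  moreover have "time (build_graph I (Suc t) V' Vs) \<le> length Vs * (61 * n\<^sup>2 + 2 * n + 3) + 1"
    using Cons by simp
  ultimately show ?case by simp
qed simp

lemma length_build_graph: "length (result (build_graph I t V Vs)) = length Vs"
  by (induction Vs arbitrary: t V) auto

lemma build_graph_dims:
  assumes "length V \<le> n" "\<And>V'. V' \<in> set Vs \<Longrightarrow> length V' \<le> n"
    and "M \<in> set (result (build_graph I t V Vs))"
  shows "length M \<le> n \<and> (\<forall>row\<in>set M. length row \<le> n)"
  using assms by (induction Vs arbitrary: t V) auto

lemma time_extend_labels: "time (extend_labels lbs as) \<le> 3 * length as + 1"
proof (induction lbs as rule: extend_labels.induct)
  case (1 lb lbs a as)
  have "time (extend_label lb a) \<le> 2" by (simp add: extend_label_def split: option.splits)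
  then show ?case using 1 by simp
qed simp_all

lemma length_extend_labels_le: "length (result (extend_labels lbs as)) \<le> length as"
  by (induction lbs as rule: extend_labels.induct) auto

lemma time_longest_path:
  assumes "\<And>M. M \<in> set Ms \<Longrightarrow> length M \<le> n \<and> (\<forall>row\<in>set M. length row \<le> n)"
    and "length lbs \<le> n"
  shows "time (longest_path lbs Ms) \<le> length Ms * (7 * n\<^sup>2 + 4 * n + 1) + 4 * n + 2"
  using assms
proof (induction Ms arbitrary: lbs)
  case Nil
  then show ?case using time_best_label[of lbs] by simp
next
  case (Cons M Ms)
  let ?f = "\<lambda>row. bind_timed (extend_labels lbs row) best_label"
  have "time (?f row) \<le> 7 * n + 3" if "row \<in> set M" for row
    using time_extend_labels[of lbs row] length_extend_labels_le[of lbs row] Cons.prems(1)[of M] that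
      time_best_label[of "result (extend_labels lbs row)"] by fastforce
  then have "time (map_timed ?f M) \<le> length M * (7 * n + 3 + 1) + 1"
    by (rule time_map_timed)
  also have "\<dots> \<le> n * (7 * n + 3 + 1) + 1"
    using Cons.prems(1)[of M] by (intro add_mono mult_mono) auto
  finally have "time (map_timed ?f M) \<le> 7 * n\<^sup>2 + 4 * n + 1"
    by (simp add: power2_eq_square algebra_simps)
  moreover have "time (longest_path (result (map_timed ?f M)) Ms)
      \<le> length Ms * (7 * n\<^sup>2 + 4 * n + 1) + 4 * n + 2"
    using Cons.prems by (intro Cons.IH) auto
  ultimately show ?case by (simp del: result_map_timed)
qed

lemma time_algorithm1:
  assumes "length Vs \<ge> 1" "n \<ge> 1" "\<And>V. V \<in> set Vs \<Longrightarrow> length V \<le> n"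
    and "\<And>i. i < length Vs \<Longrightarrow> nonneg_bounds I (1 + i)"
  shows "time (algorithm1 I Vs) \<le> 100 * length Vs * n\<^sup>2"
proof -
  let ?G = "build_graph I 1 [s0 I] Vs"
  let ?P = "longest_path [Some (0, [])] (result ?G)"
  have G: "time ?G \<le> length Vs * (61 * n\<^sup>2 + 2 * n + 3) + 1"
    using assms by (intro time_build_graph) auto
  have P: "time ?P \<le> length Vs * (7 * n\<^sup>2 + 4 * n + 1) + 4 * n + 2"
    using time_longest_path[of "result ?G" n "[Some (0, [])]"] build_graph_dims[of "[s0 I]" n Vs]
      assms(2,3) by (simp add: length_build_graph)
  \<comment> \<open>A path has one arc per layer, so reversing it takes linear time.\<close>
  have "length qs = length Vs" if "result ?P = Some (v, qs)" for v qs
    using longest_path_sound[OF assms(4) _ that] by (auto dest: list_all2_lengthD)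
  then have "time (algorithm1 I Vs) \<le> time ?G + time ?P + 2 * length Vs + 2"
    by (auto simp: algorithm1_def split: option.splits)
  also have "\<dots> \<le> length Vs * (68 * n\<^sup>2 + 6 * n + 6) + 4 * n + 5"
    using G P by (simp add: algebra_simps)
  \<comment> \<open>The additive terms are absorbed because there is at least one layer.\<close>
  also have "\<dots> \<le> length Vs * (68 * n\<^sup>2 + 6 * n + 6) + length Vs * (4 * n + 5)"
    using assms(1) by simp
  also have "\<dots> = length Vs * (68 * n\<^sup>2 + 10 * n + 11)"
    by (simp add: algebra_simps)
  also have "\<dots> \<le> length Vs * (100 * n\<^sup>2)"
  proof (rule mult_left_mono)
    have "n \<le> n\<^sup>2" "1 \<le> n\<^sup>2" using assms(2) by (simp_all add: power2_eq_square)
    then show "68 * n\<^sup>2 + 10 * n + 11 \<le> 100 * n\<^sup>2" by linarith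
  qed simp
  finally show ?thesis by (simp add: algebra_simps)
qed


section \<open>Vertices of the stock polytope\<close>

text \<open>The ratio test of the simplex method, with slacks \<open>\<alpha>\<close> and rates of
  change \<open>\<beta>\<close>: \<open>l\<close> is the smallest ratio over the decreasing slacks.
  The third assumption keeps zero slacks out of this minimum, so that \<open>l\<close> is
  positive.\<close>

lemma first_hit:
  fixes \<alpha> \<beta> :: "'a \<Rightarrow> real"
  assumes "finite F" "\<And>c. c \<in> F \<Longrightarrow> 0 \<le> \<alpha> c" "\<And>c. c \<in> F \<Longrightarrow> \<alpha> c = 0 \<Longrightarrow> \<beta> c = 0"
    and "c0 \<in> F" "\<beta> c0 < 0"
  obtains l c where "0 < l" "\<And>c. c \<in> F \<Longrightarrow> 0 \<le> \<alpha> c + l * \<beta> c"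
    and "c \<in> F" "\<alpha> c \<noteq> 0" "\<alpha> c + l * \<beta> c = 0"
proof -
  define N where "N = {c \<in> F. \<beta> c < 0}"
  define l where "l = Min ((\<lambda>c. \<alpha> c / - \<beta> c) ` N)"
  have N: "finite N" "N \<noteq> {}" using assms by (auto simp: N_def)
  then have "l \<in> (\<lambda>c. \<alpha> c / - \<beta> c) ` N" unfolding l_def by (intro Min_in) auto
  then obtain c where c: "c \<in> N" "l = \<alpha> c / - \<beta> c" by auto
  have le: "l \<le> \<alpha> c' / - \<beta> c'" if "c' \<in> N" for c'
    using N that by (auto simp: l_def)
  have a: "0 < \<alpha> c" if "c \<in> N" for c
    using that assms(2)[of c] assms(3)[of c] by (force simp: N_def)
  have l: "0 < l" using c a[OF c(1)] by (simp add: N_def divide_pos_neg)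
  show ?thesis
  proof
    show "0 < l" by (rule l)
    show "c \<in> F" "\<alpha> c \<noteq> 0" "\<alpha> c + l * \<beta> c = 0"
      using c a[OF c(1)] by (auto simp: N_def)
    show "0 \<le> \<alpha> c' + l * \<beta> c'" if "c' \<in> F" for c'
    proof (cases "\<beta> c' < 0")
      case True
      then show ?thesis using le[of c'] that by (simp add: N_def field_simps)
    next
      case False
      then show ?thesis using assms(2)[OF that] l by simp
    qed
  qed
qed

text \<open>Names for the inequalities, so that the tight ones form a finite set that can be
  compared and counted.\<close>

datatype bound = Lower_Stock nat | Upper_Stock nat | Lower_Step nat | Upper_Step nat

text \<open>Stocks are indexed from 0: \<open>s 0\<close> is the initial stock, which has no bounds
  of its own and enters only through the first step. The vectors \<open>a\<close> and
  \<open>b\<close> bound the stock differences.\<close>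

locale stock_polytope =
  fixes T :: nat and L U a b :: "nat \<Rightarrow> real"
begin

primrec slack :: "(nat \<Rightarrow> real) \<Rightarrow> bound \<Rightarrow> real" where
  "slack s (Lower_Stock t) = s t - L t"
| "slack s (Upper_Stock t) = U t - s t"
| "slack s (Lower_Step t) = s t - s (t - 1) - a t"
| "slack s (Upper_Step t) = b t - (s t - s (t - 1))"

primrec slope :: "(nat \<Rightarrow> real) \<Rightarrow> bound \<Rightarrow> real" where
  "slope d (Lower_Stock t) = d t"
| "slope d (Upper_Stock t) = - d t"
| "slope d (Lower_Step t) = d t - d (t - 1)"
| "slope d (Upper_Step t) = d (t - 1) - d t"

definition bounds :: "bound set" where
  "bounds = Lower_Stock ` {1..T} \<union> Upper_Stock ` {1..T} \<union> Lower_Step ` {1..T} \<union> Upper_Step ` {1..T}"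

definition feasible :: "(nat \<Rightarrow> real) \<Rightarrow> bool" where
  "feasible s \<longleftrightarrow> (\<forall>c\<in>bounds. 0 \<le> slack s c)"

definition tight :: "(nat \<Rightarrow> real) \<Rightarrow> bound set" where
  "tight s = {c \<in> bounds. slack s c = 0}"

text \<open>The first alternative reaches back to the initial stock or to a stock at its bound and
  leads to \<open>A_set\<close>; the second reaches forward and leads to \<open>B_set\<close>. A
  stock at its own bound is the case \<open>k = t\<close>.\<close>

definition anchored :: "(nat \<Rightarrow> real) \<Rightarrow> nat \<Rightarrow> bool" where
  "anchored s t \<longleftrightarrow>
     (\<exists>k\<le>t. (k = 0 \<or> s k \<in> {L k, U k}) \<and> (\<forall>i\<in>{k<..t}. s i - s (i - 1) \<in> {a i, b i})) \<or>
     (\<exists>k\<in>{t<..T}. s k \<in> {L k, U k} \<and> (\<forall>i\<in>{t<..k}. s i - s (i - 1) \<in> {a i, b i}))"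

lemma finite_bounds: "finite bounds"
  by (simp add: bounds_def)

lemma slack_move: "slack (\<lambda>i. s i + l * d i) c = slack s c + l * slope d c"
  by (cases c) (simp_all add: algebra_simps)

lemma slope_uminus: "slope (\<lambda>i. - d i) c = - slope d c"
  by (cases c) simp_all

lemma feasible_iff: "feasible s \<longleftrightarrow> (\<forall>t\<in>{1..T}. L t \<le> s t \<and> s t \<le> U t \<and>
    a t \<le> s t - s (t - 1) \<and> s t - s (t - 1) \<le> b t)"
  unfolding feasible_def bounds_def ball_Un ball_simps by auto

text \<open>\<open>c0\<close> guarantees that the ray eventually leaves the polytope. Tight
  constraints have slope 0 and stay tight, and the constraint that stops the move was not tight
  before, so the inclusion is strict.\<close>

lemma move_until_tight:
  assumes "feasible s" "\<And>c. c \<in> tight s \<Longrightarrow> slope d c = 0" "c0 \<in> bounds" "slope d c0 < 0"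
  obtains l where "0 < l" "feasible (\<lambda>i. s i + l * d i)" "tight s \<subset> tight (\<lambda>i. s i + l * d i)"
proof -
  obtain l c where l: "0 < l" "\<And>c. c \<in> bounds \<Longrightarrow> 0 \<le> slack s c + l * slope d c"
    and c: "c \<in> bounds" "slack s c \<noteq> 0" "slack s c + l * slope d c = 0"
    using first_hit[of bounds "slack s" "slope d" c0] assms finite_bounds
    unfolding feasible_def tight_def by blast
  have "tight s \<subset> tight (\<lambda>i. s i + l * d i)"
    using assms(2) c by (auto simp: tight_def slack_move)
  moreover have "feasible (\<lambda>i. s i + l * d i)"
    using l(2) by (simp add: feasible_def slack_move)
  ultimately show ?thesis using l(1) that by blast
qed

text \<open>If \<open>t\<close> is not anchored, the indices joined to \<open>t\<close> by tight steps can be shifted together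
  in both directions without violating any tight constraint.\<close>

lemma shift_direction:
  assumes "t \<in> {1..T}" "\<not> anchored s t"
  obtains d where "d 0 = 0" "\<And>c. c \<in> tight s \<Longrightarrow> slope d c = 0" "d t = 1"
proof -
  define ti where "ti i \<longleftrightarrow> s i - s (i - 1) \<in> {a i, b i}" for i
  \<comment> \<open>For each \<open>i\<close> at least one of the two ranges is empty, so
    \<open>C\<close> is the maximal interval of indices around \<open>t\<close> joined by tight
    steps. A priori it may contain 0; the next claim excludes 0 and all stocks at a bound, as they
    would anchor \<open>t\<close>.\<close>
  define C where "C = {i. i \<le> T \<and> (\<forall>m\<in>{i<..t}. ti m) \<and> (\<forall>m\<in>{t<..i}. ti m)}"
  define d :: "nat \<Rightarrow> real" where "d = indicator C"
  have na: "\<not> (k = 0 \<or> s k \<in> {L k, U k})" if "k \<in> C" for k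
  proof (cases "k \<le> t")
    case True
    then show ?thesis using assms that unfolding anchored_def C_def ti_def by blast
  next
    case False
    then have "k \<in> {t<..T}" using that by (auto simp: C_def)
    then show ?thesis using assms that False unfolding anchored_def C_def ti_def
      by (metis (no_types, lifting) mem_Collect_eq less_nat_zero_code greaterThanAtMost_iff)
  qed
  \<comment> \<open>A tight step never crosses the border of \<open>C\<close>, so shifting
    \<open>C\<close> preserves its stock difference.\<close>
  have step: "m \<in> C \<longleftrightarrow> m - 1 \<in> C" if "m \<in> {1..T}" "ti m" for m
  proof -
    have 1: "{m - 1<..t} = (if m \<le> t then insert m {m<..t} else {})" using that(1) by auto
    have 2: "{t<..m} = (if t < m then insert m {t<..m - 1} else {})" using that(1) by auto
    have 3: "{t<..m - 1} = {}" if "m \<le> t" using that by auto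
    have 4: "{m<..t} = {}" if "t < m" using that by auto
    show ?thesis using that 1 2 3 4 by (cases "m \<le> t") (auto simp: C_def)
  qed
  have "d 0 = 0" using na[of 0] by (auto simp: d_def indicator_def)
  moreover have "d t = 1" using assms(1) by (simp add: d_def C_def)
  moreover have "slope d c = 0" if "c \<in> tight s" for c
  proof (cases c)
    case (Lower_Stock k)
    then show ?thesis using that na[of k] by (auto simp: tight_def d_def indicator_def)
  next
    case (Upper_Stock k)
    then show ?thesis using that na[of k] by (auto simp: tight_def d_def indicator_def)
  next
    case (Lower_Step m)
    then have "m \<in> {1..T}" "ti m" using that by (auto simp: tight_def bounds_def ti_def)
    then show ?thesis using step Lower_Step by (simp add: d_def indicator_def)
  next
    case (Upper_Step m)
    then have "m \<in> {1..T}" "ti m" using that by (auto simp: tight_def bounds_def ti_def)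
    then show ?thesis using step Upper_Step by (simp add: d_def indicator_def)
  qed
  ultimately show ?thesis using that by blast
qed

text \<open>The assumption on \<open>f\<close> is quasiconvexity along lines, stated for unequal
  lengths because the two shifts stop at different distances. What is maximised is the number of
  tight constraints, over the feasible points with the same initial stock and no smaller
  \<open>f\<close>; it is bounded, so a maximum exists.\<close>

lemma anchored_improvement:
  assumes "feasible s"
    and f: "\<And>s d l l'. 0 < l \<Longrightarrow> 0 < l' \<Longrightarrow>
          f s \<le> max (f (\<lambda>i. s i + l * d i)) (f (\<lambda>i. s i - l' * d i))"
  obtains s' where "feasible s'" "s' 0 = s 0" "(f s :: real) \<le> f s'" "\<And>t. t \<in> {1..T} \<Longrightarrow> anchored s' t"
proof -
  define P where "P s' \<longleftrightarrow> feasible s' \<and> s' 0 = s 0 \<and> f s \<le> f s'" for s'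
  have fin: "finite (tight s')" for s' using finite_bounds by (simp add: tight_def)
  have "card (tight s') \<le> card bounds" for s'
    using finite_bounds by (intro card_mono) (auto simp: tight_def)
  moreover have "P s" using assms(1) by (simp add: P_def)
  ultimately obtain s' where s': "P s'" and max: "\<And>s''. P s'' \<Longrightarrow> card (tight s'') \<le> card (tight s')"
    using ex_has_greatest_nat[of P s "\<lambda>s. card (tight s)" "Suc (card bounds)"] by (force simp: less_Suc_eq_le)
  have "anchored s' t" if t: "t \<in> {1..T}" for t
  proof (rule ccontr)
    assume "\<not> anchored s' t"
    then obtain d where d: "d 0 = 0" "\<And>c. c \<in> tight s' \<Longrightarrow> slope d c = 0" "d t = 1"
      using shift_direction t by blast
    have bnd: "Upper_Stock t \<in> bounds" "Lower_Stock t \<in> bounds" using t by (auto simp: bounds_def)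
    \<comment> \<open>Since \<open>d t = 1\<close>, the upper bound on stock \<open>t\<close> stops
      the upward shift at the latest, and the lower bound stops the downward one.\<close>
    obtain l where l: "0 < l" "feasible (\<lambda>i. s' i + l * d i)" "tight s' \<subset> tight (\<lambda>i. s' i + l * d i)"
      using move_until_tight[of s' d "Upper_Stock t"] s' d bnd by (auto simp: P_def)
    obtain l' where l': "0 < l'" "feasible (\<lambda>i. s' i + l' * - d i)"
      "tight s' \<subset> tight (\<lambda>i. s' i + l' * - d i)"
      using move_until_tight[of s' "\<lambda>i. - d i" "Lower_Stock t"] s' d bnd
      by (auto simp: P_def slope_uminus)
    have "f s \<le> max (f (\<lambda>i. s' i + l * d i)) (f (\<lambda>i. s' i - l' * d i))"
      using s' f[OF l(1) l'(1), of s' d] by (simp add: P_def)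
    then have "P (\<lambda>i. s' i + l * d i) \<or> P (\<lambda>i. s' i + l' * - d i)"
      using s' l(2) l'(2) d(1) by (auto simp: P_def max_def split: if_splits)
    moreover have "card (tight s') < card (tight (\<lambda>i. s' i + l * d i))"
      "card (tight s') < card (tight (\<lambda>i. s' i + l' * - d i))"
      using l(3) l'(3) fin by (auto intro: psubset_card_mono)
    ultimately show False using max by (meson not_less)
  qed
  then show ?thesis using s' that by (auto simp: P_def)
qed

end

section \<open>Candidate stocks\<close>

text \<open>The stock changes of a tight step; 0 stands for a flow that is switched off, and also
  for periods outside a chain of tight steps.\<close>

definition moves :: "wp \<Rightarrow> nat \<Rightarrow> real set" where
  "moves I i = {0, - Ly I i, - Uy I i, Lx I i, Ux I i}"

definition flows :: "wp \<Rightarrow> nat set \<Rightarrow> real set" where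
  "flows I J = {\<Sum>i\<in>J. m i | m. \<forall>i\<in>J. m i \<in> moves I i}"

text \<open>0/1 coefficients with sum at most 1 select at most one of the four values, so the four
  coefficient vectors of the candidate sets amount to one choice from \<open>moves\<close> per
  period.\<close>

lemma moves_iff: "r \<in> moves I i \<longleftrightarrow> (\<exists>v v' u u'. v \<in> {0, 1} \<and> v' \<in> {0, 1} \<and> u \<in> {0, 1} \<and> u' \<in> {0, 1} \<and>
    v + v' + u + u' \<le> 1 \<and> r = - (v * Ly I i + v' * Uy I i) + (u * Lx I i + u' * Ux I i))" (is "?l \<longleftrightarrow> ?r")
proof
  assume ?l
  then consider "r = 0" | "r = - Ly I i" | "r = - Uy I i" | "r = Lx I i" | "r = Ux I i"
    by (auto simp: moves_def)
  then show ?r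
  proof cases
    case 1 then show ?thesis by (intro exI[of _ 0]) auto
  next
    case 2 then show ?thesis by (intro exI[of _ 1] exI[of _ 0]) auto
  next
    case 3 show ?thesis by (rule exI[of _ 0], rule exI[of _ 1], intro exI[of _ 0]) (simp add: 3)
  next
    case 4 show ?thesis
      by (rule exI[of _ 0], rule exI[of _ 0], rule exI[of _ 1], rule exI[of _ 0]) (simp add: 4)
  next
    case 5 show ?thesis
      by (rule exI[of _ 0], rule exI[of _ 0], rule exI[of _ 0], rule exI[of _ 1]) (simp add: 5)
  qed
next
  assume ?r
  then show ?l by (auto simp: moves_def)
qed

lemma flows_coefficients:
  "r \<in> flows I J \<longleftrightarrow> (\<exists>v v' u u'. (\<forall>i\<in>J. v i \<in> {0, 1} \<and> v' i \<in> {0, 1} \<and> u i \<in> {0, 1} \<and> u' i \<in> {0, 1} \<and>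
      v i + v' i + u i + u' i \<le> 1) \<and>
    r = - (\<Sum>i\<in>J. v i * Ly I i + v' i * Uy I i) + (\<Sum>i\<in>J. u i * Lx I i + u' i * Ux I i))" (is "?l \<longleftrightarrow> ?r")
proof
  assume ?l
  then obtain m where m: "\<forall>i\<in>J. m i \<in> moves I i" "r = (\<Sum>i\<in>J. m i)"
    by (auto simp: flows_def)
  from m(1) obtain v v' u u' where c: "\<forall>i\<in>J. v i \<in> {0, 1} \<and> v' i \<in> {0, 1} \<and> u i \<in> {0, 1} \<and> u' i \<in> {0, 1} \<and>
      v i + v' i + u i + u' i \<le> 1 \<and> m i = - (v i * Ly I i + v' i * Uy I i) + (u i * Lx I i + u' i * Ux I i)"
    unfolding moves_iff by metis
  have "r = (\<Sum>i\<in>J. - (v i * Ly I i + v' i * Uy I i) + (u i * Lx I i + u' i * Ux I i))"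
    unfolding m(2) using c by (intro sum.cong) auto
  also have "\<dots> = - (\<Sum>i\<in>J. v i * Ly I i + v' i * Uy I i) + (\<Sum>i\<in>J. u i * Lx I i + u' i * Ux I i)"
    unfolding sum.distrib[of "\<lambda>i. - (v i * Ly I i + v' i * Uy I i)"] sum_negf ..
  finally show ?r using c by blast
next
  assume ?r
  then obtain v v' u u' where c: "\<forall>i\<in>J. v i \<in> {0, 1} \<and> v' i \<in> {0, 1} \<and> u i \<in> {0, 1} \<and> u' i \<in> {0, 1} \<and>
      v i + v' i + u i + u' i \<le> 1"
    and r: "r = - (\<Sum>i\<in>J. v i * Ly I i + v' i * Uy I i) + (\<Sum>i\<in>J. u i * Lx I i + u' i * Ux I i)"
    by blast
  define m where "m i = - (v i * Ly I i + v' i * Uy I i) + (u i * Lx I i + u' i * Ux I i)" for i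
  have "m i \<in> moves I i" if "i \<in> J" for i
    unfolding moves_iff m_def using c that by blast
  moreover have "r = (\<Sum>i\<in>J. m i)"
    unfolding r m_def sum.distrib[of "\<lambda>i. - (v i * Ly I i + v' i * Uy I i)"] sum_negf ..
  ultimately show ?l by (auto simp: flows_def)
qed

lemma A_set_flows:
  "A_set I t = {K + p | K p. K \<in> {s0 I} \<union> Us I ` {1..t} \<union> Ls I ` {1..t} \<and> p \<in> flows I {1..t}}"
proof (intro set_eqI iffI)
  fix r assume "r \<in> A_set I t"
  then obtain K v v' u u' where K: "K \<in> {s0 I} \<union> Us I ` {1..t} \<union> Ls I ` {1..t}"
    and c: "\<forall>i\<in>{1..t}. v i \<in> {0, 1} \<and> v' i \<in> {0, 1} \<and> u i \<in> {0, 1} \<and> u' i \<in> {0, 1} \<and>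
      v i + v' i + u i + u' i \<le> 1"
    and r: "r = K - (\<Sum>i=1..t. v i * Ly I i + v' i * Uy I i) + (\<Sum>i=1..t. u i * Lx I i + u' i * Ux I i)"
    unfolding A_set_def by blast
  have "r - K \<in> flows I {1..t}"
    unfolding flows_coefficients
    by (rule exI[of _ v], rule exI[of _ v'], rule exI[of _ u], rule exI[of _ u']) (use c r in simp)
  then show "r \<in> {K + p | K p. K \<in> {s0 I} \<union> Us I ` {1..t} \<union> Ls I ` {1..t} \<and> p \<in> flows I {1..t}}"
    using K by (intro CollectI exI[of _ K] exI[of _ "r - K"]) auto
next
  fix r assume "r \<in> {K + p | K p. K \<in> {s0 I} \<union> Us I ` {1..t} \<union> Ls I ` {1..t} \<and> p \<in> flows I {1..t}}"
  then obtain K p where K: "K \<in> {s0 I} \<union> Us I ` {1..t} \<union> Ls I ` {1..t}" and p: "p \<in> flows I {1..t}"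
    and r: "r = K + p" by blast
  from p obtain v v' u u' where c: "\<forall>i\<in>{1..t}. v i \<in> {0, 1} \<and> v' i \<in> {0, 1} \<and> u i \<in> {0, 1} \<and> u' i \<in> {0, 1} \<and>
      v i + v' i + u i + u' i \<le> 1"
    and p': "p = - (\<Sum>i=1..t. v i * Ly I i + v' i * Uy I i) + (\<Sum>i=1..t. u i * Lx I i + u' i * Ux I i)"
    unfolding flows_coefficients by blast
  have "r = K - (\<Sum>i=1..t. v i * Ly I i + v' i * Uy I i) + (\<Sum>i=1..t. u i * Lx I i + u' i * Ux I i)"
    using r p' by simp
  then show "r \<in> A_set I t"
    unfolding A_set_def using K c by blast
qed

text \<open>The known stock lies in the future here, so the net flow from \<open>t\<close> up to it
  is subtracted.\<close>

lemma B_set_flows: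
  "B_set I t = {K - p | K p. K \<in> Us I ` {t+1..horizon I} \<union> Ls I ` {t+1..horizon I} \<and>
     p \<in> flows I {t+1..horizon I}}"
proof (intro set_eqI iffI)
  fix r assume "r \<in> B_set I t"
  then obtain K v v' u u' where K: "K \<in> Us I ` {t+1..horizon I} \<union> Ls I ` {t+1..horizon I}"
    and c: "\<forall>i\<in>{t+1..horizon I}. v i \<in> {0, 1} \<and> v' i \<in> {0, 1} \<and> u i \<in> {0, 1} \<and> u' i \<in> {0, 1} \<and>
      v i + v' i + u i + u' i \<le> 1"
    and r: "r = K + (\<Sum>i=t+1..horizon I. v i * Ly I i + v' i * Uy I i)
      - (\<Sum>i=t+1..horizon I. u i * Lx I i + u' i * Ux I i)"
    unfolding B_set_def by blast
  have "K - r \<in> flows I {t+1..horizon I}"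
    unfolding flows_coefficients
    by (rule exI[of _ v], rule exI[of _ v'], rule exI[of _ u], rule exI[of _ u']) (use c r in simp)
  then show "r \<in> {K - p | K p. K \<in> Us I ` {t+1..horizon I} \<union> Ls I ` {t+1..horizon I} \<and>
     p \<in> flows I {t+1..horizon I}}"
    using K by (intro CollectI exI[of _ K] exI[of _ "K - r"]) auto
next
  fix r assume "r \<in> {K - p | K p. K \<in> Us I ` {t+1..horizon I} \<union> Ls I ` {t+1..horizon I} \<and>
     p \<in> flows I {t+1..horizon I}}"
  then obtain K p where K: "K \<in> Us I ` {t+1..horizon I} \<union> Ls I ` {t+1..horizon I}"
    and p: "p \<in> flows I {t+1..horizon I}" and r: "r = K - p" by blast
  from p obtain v v' u u' where c: "\<forall>i\<in>{t+1..horizon I}. v i \<in> {0, 1} \<and> v' i \<in> {0, 1} \<and> u i \<in> {0, 1} \<and>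
      u' i \<in> {0, 1} \<and> v i + v' i + u i + u' i \<le> 1"
    and p': "p = - (\<Sum>i=t+1..horizon I. v i * Ly I i + v' i * Uy I i)
      + (\<Sum>i=t+1..horizon I. u i * Lx I i + u' i * Ux I i)"
    unfolding flows_coefficients by blast
  have "r = K + (\<Sum>i=t+1..horizon I. v i * Ly I i + v' i * Uy I i)
      - (\<Sum>i=t+1..horizon I. u i * Lx I i + u' i * Ux I i)"
    using r p' by simp
  then show "r \<in> B_set I t"
    unfolding B_set_def using K c by blast
qed

text \<open>Periods outside \<open>J'\<close> get the move 0. This is needed because a tight chain
  covers only \<open>{k<..t}\<close> or \<open>{t<..k}\<close>, whereas the candidate sets sum over
  all periods up to \<open>t\<close> or all periods after it.\<close>

lemma flows_subset:
  assumes "finite J" "J' \<subseteq> J" "\<And>i. i \<in> J' \<Longrightarrow> m i \<in> moves I i"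
  shows "(\<Sum>i\<in>J'. m i) \<in> flows I J"
proof -
  let ?m = "\<lambda>i. if i \<in> J' then m i else 0"
  have "(\<Sum>i\<in>J'. m i) = (\<Sum>i\<in>J. ?m i)"
    using assms(1,2) by (simp add: sum.If_cases Int_absorb1)
  moreover have "\<forall>i\<in>J. ?m i \<in> moves I i" using assms(3) by (auto simp: moves_def)
  ultimately show ?thesis unfolding flows_def by blast
qed

lemma sum_steps:
  fixes s :: "nat \<Rightarrow> real"
  assumes "k \<le> t"
  shows "(\<Sum>i\<in>{k<..t}. s i - s (i - 1)) = s t - s k"
  using assms
proof (induction t rule: dec_induct)
  case (step n)
  have "{k<..Suc n} = insert (Suc n) {k<..n}" using step by auto
  then show ?case using step by simp
qed simp

text \<open>The tight steps between \<open>t\<close> and its anchor \<open>k\<close> telescope, to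
  \<open>s t - s k\<close> for an earlier anchor and to \<open>s k - s t\<close> for a later
  one.\<close>

lemma anchored_in_stock_set:
  assumes "stock_polytope.anchored (horizon I) (Ls I) (Us I) a b s t"
    and ab: "\<And>i. i \<in> {1..horizon I} \<Longrightarrow> a i \<in> moves I i \<and> b i \<in> moves I i"
    and "s 0 = s0 I" "t \<in> {1..horizon I}" "Ls I t \<le> s t" "s t \<le> Us I t"
  shows "s t \<in> stock_set I t"
proof -
  let ?tight = "\<lambda>i. s i - s (i - 1) \<in> {a i, b i}"
  have mv: "s i - s (i - 1) \<in> moves I i" if "?tight i" "i \<in> {1..horizon I}" for i
    using ab[of i] that by auto
  consider (A) k where "k \<le> t" "k = 0 \<or> s k \<in> {Ls I k, Us I k}" "\<forall>i\<in>{k<..t}. ?tight i"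
    | (B) k where "k \<in> {t<..horizon I}" "s k \<in> {Ls I k, Us I k}" "\<forall>i\<in>{t<..k}. ?tight i"
    using assms(1) unfolding stock_polytope.anchored_def by blast
  then have "s t \<in> A_set I t \<union> B_set I t"
  proof cases
    case A
    have "(\<Sum>i\<in>{k<..t}. s i - s (i - 1)) \<in> flows I {1..t}"
      using A assms(4) by (intro flows_subset mv) auto
    then have "s t - s k \<in> flows I {1..t}" unfolding sum_steps[OF A(1)] .
    moreover have "s k \<in> {s0 I} \<union> Us I ` {1..t} \<union> Ls I ` {1..t}"
      using A(1,2) assms(3) by (cases "k = 0") auto
    ultimately have "s k + (s t - s k) \<in> A_set I t" unfolding A_set_flows by blast
    then show ?thesis by simp
  next
    case B
    have "(\<Sum>i\<in>{t<..k}. s i - s (i - 1)) \<in> flows I {t+1..horizon I}"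
      using B by (intro flows_subset mv) auto
    then have "s k - s t \<in> flows I {t+1..horizon I}" using B(1) by (subst (asm) sum_steps) auto
    moreover have "s k \<in> Us I ` {t+1..horizon I} \<union> Ls I ` {t+1..horizon I}"
      using B(1,2) by auto
    ultimately have "s k - (s k - s t) \<in> B_set I t" unfolding B_set_flows by blast
    then show ?thesis by simp
  qed
  then show ?thesis using assms(5,6) by (simp add: stock_set_def)
qed


section \<open>Correctness of the algorithm\<close>

lemma walk_iff_nth: "walk I t s ps \<longleftrightarrow>
    (\<forall>i<length ps. transition I (t + i) (if i = 0 then s else stock (ps ! (i - 1))) (ps ! i))"
proof (induction ps arbitrary: t s)
  case (Cons q ps)
  have "(\<forall>i<length (q # ps). transition I (t + i) (if i = 0 then s else stock ((q # ps) ! (i - 1))) ((q # ps) ! i))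
    \<longleftrightarrow> transition I t s q \<and>
        (\<forall>i<length ps. transition I (Suc t + i) (if i = 0 then stock q else stock (ps ! (i - 1))) (ps ! i))"
    (is "?l \<longleftrightarrow> ?r")
  proof
    assume l: ?l
    have "transition I (Suc t + i) (if i = 0 then stock q else stock (ps ! (i - 1))) (ps ! i)"
      if "i < length ps" for i
      using l[rule_format, of "Suc i"] that by (cases i) auto
    then show ?r using l[rule_format, of 0] by auto
  next
    assume r: ?r
    show ?l
    proof (intro allI impI)
      fix i assume "i < length (q # ps)"
      then show "transition I (t + i) (if i = 0 then s else stock ((q # ps) ! (i - 1))) ((q # ps) ! i)"
        using r by (cases i; cases "i - 1") auto
    qed
  qed
  then show ?case using Cons by simp
qed simp

lemma payoff_eq_sum: "payoff I t ps = (\<Sum>i<length ps. pay I (t + i) (ps ! i))"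
  by (induction ps arbitrary: t) (simp_all add: sum.lessThan_Suc_shift del: sum.lessThan_Suc)

lemma sum_periods: "(\<Sum>t\<in>{1..n}. g t) = (\<Sum>i<n. g (Suc i))"
  by (rule sum.reindex_bij_witness[of _ Suc "\<lambda>t. t - 1"]) auto

lemma solution_of_walk:
  assumes len: "length ps = horizon I" and walk: "walk I 1 (s0 I) ps"
    and st: "\<And>t. t \<in> {1..horizon I} \<Longrightarrow> stock (ps ! (t - 1)) \<in> {Ls I t..Us I t}"
  shows "solution_of ps \<in> Q1 I" "objective I (solution_of ps) = payoff I 1 ps"
proof -
  have tr: "transition I t (if t = 1 then s0 I else stock (ps ! (t - 1 - 1))) (ps ! (t - 1))"
    if "t \<in> {1..horizon I}" for t
  proof -
    have "t - 1 < length ps" "1 + (t - 1) = t" "t - 1 = 0 \<longleftrightarrow> t = 1" using that len by auto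
    then show ?thesis using walk[unfolded walk_iff_nth, rule_format, of "t - 1"] by simp
  qed
  show "solution_of ps \<in> Q1 I"
    unfolding solution_of_def Q1_def mem_Collect_eq prod.case len
  proof (intro conjI ballI)
    show "(\<lambda>t\<in>{1..horizon I}. case ps ! (t - 1) of (x, y, s, w, z) \<Rightarrow> w) \<in> {1..horizon I} \<rightarrow>\<^sub>E {0, 1}"
      "(\<lambda>t\<in>{1..horizon I}. case ps ! (t - 1) of (x, y, s, w, z) \<Rightarrow> z) \<in> {1..horizon I} \<rightarrow>\<^sub>E {0, 1}"
      using tr by (auto simp: transition_def split_beta)
  qed (use tr st in \<open>auto simp: transition_def split_beta\<close>)
  have "objective I (solution_of ps) = (\<Sum>t\<in>{1..horizon I}. pay I t (ps ! (t - 1)))"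
    unfolding objective_def solution_of_def prod.case len
    by (intro sum.cong) (auto simp: split_beta)
  then show "objective I (solution_of ps) = payoff I 1 ps"
    unfolding sum_periods payoff_eq_sum len by simp
qed

text \<open>Each \<open>q t\<close> is a convex combination of its two displaced points with weights
  independent of \<open>t\<close>. So the convexity inequalities add up to one between the three
  sums, and a convex combination is at most the maximum.\<close>

lemma convex_on_line_max:
  fixes q :: "'b \<Rightarrow> 'a::real_vector"
  assumes "\<And>t. t \<in> A \<Longrightarrow> convex_on UNIV (p t)" "0 < l" "0 < l'"
  shows "(\<Sum>t\<in>A. p t (q t)) \<le> max (\<Sum>t\<in>A. p t (q t + l *\<^sub>R e t)) (\<Sum>t\<in>A. p t (q t - l' *\<^sub>R e t))"
proof -
  \<comment> \<open>The weight for which the displacements by \<open>l\<close> and by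
    \<open>- l'\<close> cancel.\<close>
  define u where "u = l / (l + l')"
  have u: "0 \<le> u" "u \<le> 1" "(1 - u) * l = u * l'"
    using assms(2,3) by (simp_all add: u_def field_simps)
  have "p t (q t) \<le> (1 - u) * p t (q t + l *\<^sub>R e t) + u * p t (q t - l' *\<^sub>R e t)" if "t \<in> A" for t
  proof -
    have "(1 - u) *\<^sub>R (q t + l *\<^sub>R e t) + u *\<^sub>R (q t - l' *\<^sub>R e t)
        = q t + ((1 - u) * l - u * l') *\<^sub>R e t"
      by (simp add: algebra_simps)
    also have "\<dots> = q t" using u(3) by simp
    finally show ?thesis
      using convex_onD[OF assms(1)[OF that] u(1,2), of "q t + l *\<^sub>R e t" "q t - l' *\<^sub>R e t"] by simp
  qed
  then have "(\<Sum>t\<in>A. p t (q t)) \<le> (\<Sum>t\<in>A. (1 - u) * p t (q t + l *\<^sub>R e t) + u * p t (q t - l' *\<^sub>R e t))"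
    by (rule sum_mono)
  also have "\<dots> = (1 - u) * (\<Sum>t\<in>A. p t (q t + l *\<^sub>R e t)) + u * (\<Sum>t\<in>A. p t (q t - l' *\<^sub>R e t))"
    by (simp add: sum.distrib sum_distrib_left)
  also have "\<dots> \<le> max (\<Sum>t\<in>A. p t (q t + l *\<^sub>R e t)) (\<Sum>t\<in>A. p t (q t - l' *\<^sub>R e t))"
    using u(1,2) by (intro convex_bound_le) auto
  finally show ?thesis .
qed

text \<open>The switches and the choice of the vanishing flow are kept from \<open>q\<close>; only
  the stocks move, and the flows follow them. Applied to every \<open>q\<close>, this reduces the
  search over \<open>Q1\<close> to the layered graph.\<close>

lemma candidate_walk:
  assumes I: "wp_instance I" and q: "q \<in> Q1 I"
  obtains ps where "length ps = horizon I" "walk I 1 (s0 I) ps"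
    "\<And>t. t \<in> {1..horizon I} \<Longrightarrow> stock (ps ! (t - 1)) \<in> stock_set I t"
    "objective I q \<le> payoff I 1 ps"
proof -
  obtain x y s w z where qe: "q = (x, y, s, w, z)" by (metis prod_cases5)
  let ?T = "horizon I"
  have wz: "w t \<in> {0, 1}" "z t \<in> {0, 1}" if "t \<in> {1..?T}" for t
    using q that by (auto simp: qe Q1_def PiE_iff)
  have Q: "s t = (if t = 1 then s0 I else s (t - 1)) - y t + x t" "x t * y t = 0"
    "Ls I t \<le> s t" "s t \<le> Us I t" "Ly I t * z t \<le> y t" "y t \<le> Uy I t * z t"
    "Lx I t * w t \<le> x t" "x t \<le> Ux I t * w t" if "t \<in> {1..?T}" for t
    using q that unfolding qe Q1_def mem_Collect_eq prod.case by blast+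
  define s' where "s' t = (if t = 0 then s0 I else s t)" for t
  \<comment> \<open>If \<open>y t = 0\<close>, the step is \<open>x t\<close>; otherwise
    \<open>x t = 0\<close> and the step is \<open>- y t\<close>, so that lower and upper bound
    change places. As the switches are 0 or 1, both ends lie in \<open>moves\<close>.\<close>
  define a where "a t = (if y t = 0 then Lx I t * w t else - Uy I t * z t)" for t
  define b where "b t = (if y t = 0 then Ux I t * w t else - Ly I t * z t)" for t
  \<comment> \<open>Affine in \<open>\<sigma>\<close> with linear part \<open>e t\<close>, because
    the case distinction is on the fixed value \<open>y t\<close>.\<close>
  define pt :: "nat \<Rightarrow> (nat \<Rightarrow> real) \<Rightarrow> period_point" where
    "pt t \<sigma> = (if y t = 0 then (\<sigma> t - \<sigma> (t - 1), 0, \<sigma> t, w t, z t)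
               else (0, \<sigma> (t - 1) - \<sigma> t, \<sigma> t, w t, z t))" for t \<sigma>
  define e :: "nat \<Rightarrow> (nat \<Rightarrow> real) \<Rightarrow> period_point" where
    "e t d = (if y t = 0 then (d t - d (t - 1), 0, d t, 0, 0) else (0, d (t - 1) - d t, d t, 0, 0))" for t d
  define f where "f \<sigma> = (\<Sum>t\<in>{1..?T}. pay I t (pt t \<sigma>))" for \<sigma>
  interpret stock_polytope ?T "Ls I" "Us I" a b .
  have s': "s' t = s t" "s' t - s' (t - 1) = x t - y t" if "t \<in> {1..?T}" for t
    using that Q(1)[OF that] by (auto simp: s'_def split: if_splits)
  have feas: "feasible s'"
    unfolding feasible_iff
  proof
    fix t assume t: "t \<in> {1..?T}"
    then show "Ls I t \<le> s' t \<and> s' t \<le> Us I t \<and> a t \<le> s' t - s' (t - 1) \<and> s' t - s' (t - 1) \<le> b t"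
      using Q(2-)[OF t] unfolding s'(2)[OF t] unfolding s'(1)[OF t] by (auto simp: a_def b_def)
  qed
  have cvx: "f \<sigma> \<le> max (f (\<lambda>i. \<sigma> i + l * d i)) (f (\<lambda>i. \<sigma> i - l' * d i))"
    if "0 < l" "0 < l'" for \<sigma> d l l'
  proof -
    have pt: "pt t (\<lambda>i. \<sigma> i + l * d i) = pt t \<sigma> + l *\<^sub>R e t d"
      "pt t (\<lambda>i. \<sigma> i - l' * d i) = pt t \<sigma> - l' *\<^sub>R e t d" for t
      by (auto simp: pt_def e_def algebra_simps)
    show ?thesis
      unfolding f_def pt using I that by (intro convex_on_line_max) (auto simp: wp_instance_def)
  qed
  obtain \<sigma> where \<sigma>: "feasible \<sigma>" "\<sigma> 0 = s' 0" "f s' \<le> f \<sigma>"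
    "\<And>t. t \<in> {1..?T} \<Longrightarrow> anchored \<sigma> t"
    by (rule anchored_improvement[of s' f, OF feas cvx]) blast+
  have \<sigma>0: "\<sigma> 0 = s0 I" using \<sigma>(2) by (simp add: s'_def)
  have ab: "a t \<in> moves I t \<and> b t \<in> moves I t" if "t \<in> {1..?T}" for t
    using wz[OF that] by (auto simp: a_def b_def moves_def)
  define ps where "ps = map (\<lambda>i. pt (Suc i) \<sigma>) [0..<?T]"
  have ps: "length ps = ?T" "\<And>i. i < ?T \<Longrightarrow> ps ! i = pt (Suc i) \<sigma>"
    by (simp_all add: ps_def)
  have stock: "stock (pt t \<sigma>) = \<sigma> t" for t by (simp add: pt_def)
  show ?thesis
  proof
    show "length ps = ?T" by (rule ps)
    show "stock (ps ! (t - 1)) \<in> stock_set I t" if t: "t \<in> {1..?T}" for t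
    proof -
      have "\<sigma> t \<in> stock_set I t"
        using anchored_in_stock_set[OF \<sigma>(4)[OF t] ab \<sigma>0 t] \<sigma>(1) t by (auto simp: feasible_iff)
      moreover have "t - 1 < ?T" "Suc (t - 1) = t" using t by auto
      then have "ps ! (t - 1) = pt t \<sigma>" using ps(2)[of "t - 1"] by simp
      ultimately show ?thesis by (simp add: stock)
    qed
    show "walk I 1 (s0 I) ps"
      unfolding walk_iff_nth ps(1)
    proof (intro allI impI)
      fix i assume i: "i < ?T"
      let ?t = "Suc i"
      have t: "?t \<in> {1..?T}" using i by simp
      have "(if i = 0 then s0 I else stock (ps ! (i - 1))) = \<sigma> i"
        using i \<sigma>0 by (simp add: ps(2) stock)
      moreover have "transition I ?t (\<sigma> i) (pt ?t \<sigma>)"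
      proof -
        have "a ?t \<le> \<sigma> ?t - \<sigma> i" "\<sigma> ?t - \<sigma> i \<le> b ?t"
          using \<sigma>(1) t by (force simp: feasible_iff)+
        moreover have "0 \<le> Uy I ?t * z ?t" "y ?t = 0 \<Longrightarrow> Ly I ?t * z ?t \<le> 0"
            "y ?t \<noteq> 0 \<Longrightarrow> Lx I ?t * w ?t \<le> 0" "0 \<le> Ux I ?t * w ?t"
          using Q[OF t] wz[OF t] wp_instance_nonneg_bounds[OF I t]
          by (auto simp: nonneg_bounds_def)
        ultimately show ?thesis
          using wz[OF t] by (auto simp: transition_def pt_def a_def b_def split: if_splits)
      qed
      ultimately show "transition I (1 + i) (if i = 0 then s0 I else stock (ps ! (i - 1))) (ps ! i)"
        using i by (simp add: ps(2))
    qed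
    have "objective I q = f s'"
      unfolding objective_def f_def qe prod.case
    proof (rule sum.cong[OF refl])
      fix t assume t: "t \<in> {1..?T}"
      have "pt t s' = (x t, y t, s t, w t, z t)"
      proof (cases "y t = 0")
        case True
        then show ?thesis unfolding pt_def s'(2)[OF t] using s'(1)[OF t] by simp
      next
        case False
        then have "x t = 0" using Q(2)[OF t] by simp
        then have "s' (t - 1) - s' t = y t" using s'(2)[OF t] by simp
        then show ?thesis unfolding pt_def using s'(1)[OF t] False \<open>x t = 0\<close> by simp
      qed
      then show "pay I t (x t, y t, s t, w t, z t) = pay I t (pt t s')" by simp
    qed
    moreover have "f \<sigma> = payoff I 1 ps"
      unfolding f_def sum_periods payoff_eq_sum ps(1) by (intro sum.cong) (auto simp: ps(2))
    ultimately show "objective I q \<le> payoff I 1 ps" using \<sigma>(3) by simp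
  qed
qed

lemma algorithm1_solves:
  assumes I: "wp_instance I" and V: "node_layers I Vs"
  shows "solves I (result (algorithm1 I Vs))"
proof -
  let ?T = "horizon I"
  let ?lb = "result (longest_path [Some (0, [])] (result (build_graph I 1 [s0 I] Vs)))"
  have lenV: "length Vs = ?T" and setV: "\<And>t. t \<in> {1..?T} \<Longrightarrow> set (Vs ! (t - 1)) = stock_set I t"
    using V by (auto simp: node_layers_def)
  have nn: "nonneg_bounds I (1 + i)" if "i < length Vs" for i
    using wp_instance_nonneg_bounds[OF I, of "1 + i"] that lenV by simp
  have layers: "list_all2 (\<lambda>q V. stock q \<in> set V) ps Vs \<longleftrightarrow>
      length ps = ?T \<and> (\<forall>t\<in>{1..?T}. stock (ps ! (t - 1)) \<in> stock_set I t)" for ps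
  proof -
    have "(\<forall>t\<in>{1..?T}. stock (ps ! (t - 1)) \<in> stock_set I t) \<longleftrightarrow>
        (\<forall>t\<in>{1..?T}. stock (ps ! (t - 1)) \<in> set (Vs ! (t - 1)))"
      using setV by simp
    also have "\<dots> \<longleftrightarrow> (\<forall>i<?T. stock (ps ! i) \<in> set (Vs ! i))"
      by (force dest: bspec[where x = "Suc _"])
    finally show ?thesis using lenV by (auto simp: list_all2_conv_all_nth)
  qed
  \<comment> \<open>Without a final label there can be no feasible point; with one, \<open>v\<close>
    bounds the objective on all of \<open>Q1\<close>, and the returned path attains it.\<close>
  have complete: "\<exists>v qs. ?lb = Some (v, qs) \<and> objective I q \<le> v" if q: "q \<in> Q1 I" for q
  proof -
    obtain ps where ps: "length ps = ?T" "walk I 1 (s0 I) ps"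
      "\<And>t. t \<in> {1..?T} \<Longrightarrow> stock (ps ! (t - 1)) \<in> stock_set I t" "objective I q \<le> payoff I 1 ps"
      using candidate_walk[OF I q] by blast
    then have "list_all2 (\<lambda>q V. stock q \<in> set V) ps Vs" using layers by blast
    from longest_path_complete[of Vs I 1 "[Some (0, [])]" "[s0 I]" 0 0 "[]" ps, OF nn _ _ _ _ this]
    show ?thesis using ps(2,4) by fastforce
  qed
  show ?thesis
  proof (cases ?lb)
    case None
    then have "Q1 I = {}" using complete by fastforce
    then show ?thesis using None by (simp add: algorithm1_def solves_def)
  next
    case (Some r)
    then obtain v qs where lb: "?lb = Some (v, qs)" by (cases r) auto
    from longest_path_sound[of Vs I 1 "[Some (0, [])]" "[s0 I]", OF nn _ this]
    obtain ps where ps: "qs = rev ps" "walk I 1 (s0 I) ps"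
      "list_all2 (\<lambda>q V. stock q \<in> set V) ps Vs" "v = payoff I 1 ps"
      by auto
    then have len: "length ps = ?T" and "\<And>t. t \<in> {1..?T} \<Longrightarrow> stock (ps ! (t - 1)) \<in> {Ls I t..Us I t}"
      unfolding layers by (auto simp: stock_set_def)
    note sol = solution_of_walk[OF len ps(2) this(2)]
    have "optimal I (solution_of ps)"
      unfolding optimal_def using sol complete lb ps(4) by fastforce
    then show ?thesis using lb ps(1) len by (simp add: algorithm1_def solves_def)
  qed
qed

text \<open>\<open>max 1\<close> accounts for the start layer \<open>[s0 I]\<close>, which has a
  node even if all stock sets are empty; the algorithm takes time then, too.\<close>

lemma algorithm1_time:
  assumes I: "wp_instance I" and V: "node_layers I Vs"
  shows "time (algorithm1 I Vs) \<le> 100 * horizon I * (max 1 (max_stock_card I))\<^sup>2"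
proof -
  have len: "length Vs = horizon I" using V by (simp add: node_layers_def)
  have "length W \<le> max 1 (max_stock_card I)" if W: "W \<in> set Vs" for W
  proof -
    obtain i where i: "i < horizon I" "W = Vs ! i" using W len by (metis in_set_conv_nth)
    then have t: "Suc i \<in> {1..horizon I}" by simp
    then have "distinct (Vs ! i)" "set (Vs ! i) = stock_set I (Suc i)"
      using V unfolding node_layers_def by (metis diff_Suc_1)+
    then have "length W = card (stock_set I (Suc i))" using i by (metis distinct_card)
    also have "\<dots> \<le> max_stock_card I" unfolding max_stock_card_def using t by (intro Max_ge) auto
    finally show ?thesis by simp
  qed
  then show ?thesis
    using time_algorithm1[of Vs "max 1 (max_stock_card I)" I] len I wp_instance_nonneg_bounds[OF I]
    by (simp add: wp_instance_def)
qed


section \<open>Computing the layers\<close>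

lemma result_member_timed [simp]: "result (member_timed a bs) \<longleftrightarrow> a \<in> set bs"
  by (induction bs) auto

lemma time_member_timed: "time (member_timed a bs) \<le> 2 * length bs + 1"
  by (induction bs) auto

lemma set_remdups_timed [simp]: "set (result (remdups_timed as)) = set as"
  by (induction as) auto

lemma distinct_remdups_timed: "distinct (result (remdups_timed as))"
  by (induction as) auto

lemma length_remdups_timed: "length (result (remdups_timed as)) \<le> length as"
  by (induction as) auto

lemma time_remdups_timed:
  "length as \<le> n \<Longrightarrow> time (remdups_timed as) \<le> length as * (2 * n + 2) + 1"
proof (induction as)
  case (Cons a as)
  then show ?case
    using time_member_timed[of a "result (remdups_timed as)"] length_remdups_timed[of as] by simp
qed simp

lemma result_clip_timed [simp]: "result (clip_timed l u as) = filter (\<lambda>a. l \<le> a \<and> a \<le> u) as"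
  and time_clip_timed [simp]: "time (clip_timed l u as) = 3 * length as + 1"
  by (induction as) auto

lemma result_range_timed [simp]: "result (range_timed i n) = [i..<i + n]"
  by (induction n arbitrary: i) (simp_all add: upt_rec)

lemma time_range_timed [simp]: "time (range_timed i n) = 2 * n + 1"
  by (induction n arbitrary: i) auto

lemma set_stock_bounds [simp]: "set (result (stock_bounds I es)) = Us I ` set es \<union> Ls I ` set es"
  and length_stock_bounds [simp]: "length (result (stock_bounds I es)) = 2 * length es"
  and time_stock_bounds [simp]: "time (stock_bounds I es) = length es + 1"
  by (induction es) auto

lemma set_concat_map_map: "set (concat (map (\<lambda>a. map (g a) bs) as)) = (\<Union>a\<in>set as. g a ` set bs)"
  by simp

lemma flows_insert:
  assumes "finite J" "i \<notin> J"
  shows "flows I (insert i J) = {p + m | p m. p \<in> flows I J \<and> m \<in> moves I i}"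
proof (intro set_eqI iffI)
  fix r assume "r \<in> flows I (insert i J)"
  then obtain m where m: "\<forall>k\<in>insert i J. m k \<in> moves I k" "r = sum m (insert i J)"
    by (auto simp: flows_def)
  then have "r = sum m J + m i" using assms by simp
  moreover have "sum m J \<in> flows I J" using m by (auto simp: flows_def)
  ultimately show "r \<in> {p + m | p m. p \<in> flows I J \<and> m \<in> moves I i}" using m(1) by blast
next
  fix r assume "r \<in> {p + m | p m. p \<in> flows I J \<and> m \<in> moves I i}"
  then obtain m m' where m: "\<forall>k\<in>J. m k \<in> moves I k" "m' \<in> moves I i" "r = sum m J + m'"
    by (auto simp: flows_def)
  have "sum (m(i := m')) J = sum m J" using assms by (intro sum.cong) auto
  then have "r = sum (m(i := m')) (insert i J)" using m(3) assms by simp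
  moreover have "\<forall>k\<in>insert i J. (m(i := m')) k \<in> moves I k" using m(1,2) by auto
  ultimately show "r \<in> flows I (insert i J)" unfolding flows_def by blast
qed

text \<open>A repeated period would contribute two moves, which \<open>flows\<close> over a set does
  not permit; hence the distinctness.\<close>

lemma set_flow_sums: "distinct es \<Longrightarrow> set (result (flow_sums I es)) = flows I (set es)"
proof (induction es)
  case Nil
  then show ?case by (auto simp: flows_def)
next
  case (Cons i es)
  then have "set (result (flow_sums I (i # es))) = (\<Union>p\<in>flows I (set es). (\<lambda>m. p + m) ` moves I i)"
    by (simp add: moves_def)
  also have "\<dots> = flows I (set (i # es))"
    using Cons.prems by (auto simp: flows_insert)
  finally show ?case .
qed

lemma distinct_flow_sums: "distinct (result (flow_sums I es))"
  by (cases es) (simp_all add: distinct_remdups_timed)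

lemma set_make_layer:
  assumes "t \<in> {1..horizon I}"
  shows "set (result (make_layer I t)) = stock_set I t"
proof -
  let ?E = "[1..<1 + t]" and ?L = "[Suc t..<Suc t + (horizon I - t)]"
  have E: "set ?E = {1..t}" and L: "set ?L = {t+1..horizon I}" using assms by auto
  have f: "set (result (flow_sums I ?E)) = flows I {1..t}"
    "set (result (flow_sums I ?L)) = flows I {t+1..horizon I}"
    by (simp_all only: set_flow_sums distinct_upt E L)
  have "result (make_layer I t) = result (remdups_timed (filter (\<lambda>a. Ls I t \<le> a \<and> a \<le> Us I t)
      (concat (map (\<lambda>k. map (\<lambda>p. k + p) (result (flow_sums I ?E))) (s0 I # result (stock_bounds I ?E))) @
       concat (map (\<lambda>k. map (\<lambda>p. k - p) (result (flow_sums I ?L))) (result (stock_bounds I ?L))))))"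
    by (simp add: make_layer_def del: upt_Suc)
  then have "set (result (make_layer I t)) = {r \<in>
     (\<Union>k\<in>insert (s0 I) (Us I ` {1..t} \<union> Ls I ` {1..t}). (\<lambda>p. k + p) ` flows I {1..t}) \<union>
     (\<Union>k\<in>Us I ` {t+1..horizon I} \<union> Ls I ` {t+1..horizon I}. (\<lambda>p. k - p) ` flows I {t+1..horizon I}).
     Ls I t \<le> r \<and> r \<le> Us I t}"
    by (simp only: set_remdups_timed set_filter set_append set_concat_map_map list.set(2)
        set_stock_bounds f E L)
  also have "\<dots> = stock_set I t"
    unfolding stock_set_def A_set_flows B_set_flows atLeastAtMost_iff[symmetric] by blast
  finally show ?thesis .
qed

lemma distinct_make_layer: "distinct (result (make_layer I t))"
  by (simp add: make_layer_def distinct_remdups_timed)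

lemma node_layers_make_layer: "node_layers I (map (\<lambda>t. result (make_layer I t)) [1..<1 + horizon I])"
  using set_make_layer distinct_make_layer by (auto simp: node_layers_def simp del: upt_Suc)


section \<open>Pseudopolynomial running time\<close>

text \<open>Any common denominator \<open>D\<close> and any bound \<open>M\<close> on the numerators
  are allowed; the least ones are inserted only at the end.\<close>

definition integral_data :: "wp \<Rightarrow> nat \<Rightarrow> nat \<Rightarrow> bool" where
  "integral_data I D M \<longleftrightarrow> 0 < D \<and> (\<forall>r\<in>data I. \<exists>k::int. real D * r = of_int k \<and> \<bar>k\<bar> \<le> int M)"

lemma moves_integral:
  assumes "integral_data I D M" "i \<in> {1..horizon I}" "m \<in> moves I i"
  shows "\<exists>k::int. real D * m = of_int k \<and> \<bar>k\<bar> \<le> int M"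
proof -
  have "m = 0 \<or> m \<in> data I \<or> - m \<in> data I"
    using assms(2,3) by (auto simp: moves_def data_def)
  then consider "m = 0" | "m \<in> data I" | "- m \<in> data I" by blast
  then show ?thesis
  proof cases
    case 1
    then show ?thesis by (intro exI[of _ 0]) simp
  next
    case 2
    then show ?thesis using assms(1) by (simp add: integral_data_def)
  next
    case 3
    then obtain k :: int where "real D * - m = of_int k" "\<bar>k\<bar> \<le> int M"
      using assms(1) unfolding integral_data_def by blast
    then show ?thesis by (intro exI[of _ "- k"]) simp
  qed
qed

lemma card_flows:
  assumes "integral_data I D M" "J \<subseteq> {1..horizon I}"
  shows "card (flows I J) \<le> 2 * horizon I * M + 1"
proof -
  let ?c = "int (horizon I * M)"
  have D: "0 < D" using assms(1) by (simp add: integral_data_def)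
  have "flows I J \<subseteq> (\<lambda>k. of_int k / real D) ` {- ?c..?c}"
  proof
    fix r assume "r \<in> flows I J"
    then obtain m where m: "\<forall>i\<in>J. m i \<in> moves I i" "r = sum m J" by (auto simp: flows_def)
    then have "\<forall>i\<in>J. \<exists>k::int. real D * m i = of_int k \<and> \<bar>k\<bar> \<le> int M"
      using moves_integral[OF assms(1)] assms(2) by blast
    then obtain k :: "nat \<Rightarrow> int" where k: "\<forall>i\<in>J. real D * m i = of_int (k i) \<and> \<bar>k i\<bar> \<le> int M"
      by metis
    have "real D * r = of_int (sum k J)"
      unfolding m(2) sum_distrib_left of_int_sum using k by (intro sum.cong) auto
    then have "r = of_int (sum k J) / real D" using D by (simp add: field_simps)
    moreover have "\<bar>sum k J\<bar> \<le> ?c"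
    proof -
      have "\<bar>sum k J\<bar> \<le> (\<Sum>i\<in>J. \<bar>k i\<bar>)" by (rule sum_abs)
      also have "\<dots> \<le> of_nat (card J) * int M" using k by (intro sum_bounded_above) auto
      also have "\<dots> \<le> int (horizon I) * int M"
        using card_mono[OF _ assms(2)] by (intro mult_right_mono) auto
      finally show ?thesis by simp
    qed
    ultimately show "r \<in> (\<lambda>k. of_int k / real D) ` {- ?c..?c}"
      by (intro image_eqI[of _ _ "sum k J"]) (auto simp: abs_le_iff)
  qed
  then have "card (flows I J) \<le> card {- ?c..?c}" by (meson surj_card_le finite_atLeastAtMost_int)
  then show ?thesis by (simp add: nat_add_distrib nat_mult_distrib algebra_simps)
qed

lemma length_flow_sums:
  assumes "integral_data I D M" "distinct es" "set es \<subseteq> {1..horizon I}"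
  shows "length (result (flow_sums I es)) \<le> 2 * horizon I * M + 1"
  using card_flows[OF assms(1,3)] distinct_card[OF distinct_flow_sums[of I es]]
    set_flow_sums[OF assms(2), of I] by simp

text \<open>At most \<open>N\<close> distinct sums survive each period, so at most
  \<open>5 * N\<close> enter the next removal of duplicates. Comparing these pairwise dominates the
  cost, with leading term 50 N^2.\<close>

lemma time_flow_sums:
  assumes "integral_data I D M" "distinct es" "set es \<subseteq> {1..horizon I}"
  defines "N \<equiv> 2 * horizon I * M + 1"
  shows "time (flow_sums I es) \<le> length es * (100 * N\<^sup>2) + 1"
  using assms(2,3)
proof (induction es)
  case (Cons i es)
  define ps where "ps = result (flow_sums I es)"
  define ms where "ms = [0, - Ly I i, - Uy I i, Lx I i, Ux I i]"
  define qs where "qs = concat (map (\<lambda>p. map (\<lambda>m. p + m) ms) ps)"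
  have ps: "length ps \<le> N" unfolding ps_def N_def using Cons.prems by (intro length_flow_sums[OF assms(1)]) auto
  have "length qs = length ps * length ms" unfolding qs_def by (rule length_concat_map_const)
  then have qs: "length qs \<le> 5 * N" using ps by (simp add: ms_def)
  have N: "N \<le> N\<^sup>2" "1 \<le> N\<^sup>2" by (simp_all add: N_def power2_eq_square)
  have "time (flow_sums I (i # es)) = time (flow_sums I es) + 3 +
      time (product_timed (\<lambda>p m. step (p + m)) ps ms) + time (remdups_timed qs)"
    by (simp add: ps_def qs_def ms_def)
  moreover have "time (product_timed (\<lambda>p m. step (p + m)) ps ms) \<le> 18 * N + 2"
    using time_product_timed[of "\<lambda>p m. step (p + m)" ps ms] ps by (simp add: ms_def)
  moreover have "time (remdups_timed qs) \<le> 5 * N * (2 * (5 * N) + 2) + 1"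
    using time_remdups_timed[OF qs] qs by (meson order_trans add_le_mono1 mult_le_mono1)
  moreover have "5 * N * (2 * (5 * N) + 2) = 50 * N\<^sup>2 + 10 * N" by (simp add: power2_eq_square algebra_simps)
  ultimately have "time (flow_sums I (i # es)) \<le> time (flow_sums I es) + 100 * N\<^sup>2"
    using N by linarith
  then show ?case using Cons by simp
qed simp

text \<open>The base stocks are two bounds per period and \<open>s0 I\<close>, at most
  \<open>3 * T\<close> in all; each is combined with at most \<open>N\<close> sums, so there are at
  most \<open>3 * X\<close> candidates before duplicates are removed.\<close>

lemma make_layer_bounds:
  assumes I: "integral_data I D M" and t: "t \<in> {1..horizon I}"
  defines "X \<equiv> horizon I * (2 * horizon I * M + 1)"
  shows "time (make_layer I t) \<le> 400 * X\<^sup>2" "length (result (make_layer I t)) \<le> 5 * X"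
proof -
  let ?T = "horizon I"
  define N where "N = 2 * ?T * M + 1"
  define es where "es = [1..<1 + t]"
  define js where "js = [Suc t..<Suc t + (?T - t)]"
  define ks where "ks = s0 I # result (stock_bounds I es)"
  define ls where "ls = result (stock_bounds I js)"
  define ps where "ps = result (flow_sums I es)"
  define qs where "qs = result (flow_sums I js)"
  define as where "as = concat (map (\<lambda>k. map (\<lambda>p. k + p) ps) ks)"
  define bs where "bs = concat (map (\<lambda>k. map (\<lambda>p. k - p) qs) ls)"
  define cs where "cs = filter (\<lambda>a. Ls I t \<le> a \<and> a \<le> Us I t) (as @ bs)"
  have X: "X = ?T * N" by (simp add: X_def N_def)
  have pos: "1 \<le> ?T" "1 \<le> N" using t by (auto simp: N_def)
  have ij: "distinct es" "set es \<subseteq> {1..?T}" "length es \<le> ?T"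
    "distinct js" "set js \<subseteq> {1..?T}" "length js \<le> ?T" "length es + length js = ?T"
    using t by (auto simp: es_def js_def simp del: upt_Suc)
  have len: "length ps \<le> N" "length qs \<le> N" "length ks = 2 * length es + 1" "length ls = 2 * length js"
    unfolding ps_def qs_def ks_def ls_def N_def using length_flow_sums[OF I] ij by auto
  have kl: "length ks + length ls \<le> 3 * ?T" using len(3,4) ij(7) pos by linarith
  have ab: "length (as @ bs) \<le> 3 * X"
  proof -
    have "length (as @ bs) = length ks * length ps + length ls * length qs"
      by (simp only: as_def bs_def length_append length_concat_map_const)
    also have "\<dots> \<le> length ks * N + length ls * N"
      using len by (intro add_mono mult_left_mono) auto
    also have "\<dots> = (length ks + length ls) * N" by (simp add: algebra_simps)
    also have "\<dots> \<le> (3 * ?T) * N" using kl by (rule mult_right_mono) simp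
    finally show ?thesis by (simp add: X)
  qed
  then have cs: "length cs \<le> 3 * X" unfolding cs_def using length_filter_le order_trans by blast
  have res: "result (make_layer I t) = result (remdups_timed cs)"
    by (simp add: make_layer_def cs_def as_def bs_def ps_def qs_def ks_def ls_def es_def js_def del: upt_Suc)
  show "length (result (make_layer I t)) \<le> 5 * X"
    unfolding res using length_remdups_timed[of cs] cs by linarith
  have TX: "?T \<le> X" "1 \<le> X" "?T * N\<^sup>2 \<le> X\<^sup>2"
  proof -
    show "?T \<le> X" "1 \<le> X" using pos by (simp_all add: X)
    have "?T * N\<^sup>2 \<le> ?T\<^sup>2 * N\<^sup>2" using pos by (intro mult_right_mono) (simp_all add: power2_eq_square)
    then show "?T * N\<^sup>2 \<le> X\<^sup>2" by (simp add: X power_mult_distrib)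
  qed
  have XX: "X \<le> X\<^sup>2" "1 \<le> X\<^sup>2" using TX(2) by (simp_all add: power2_eq_square)
  \<comment> \<open>The two calls divide the \<open>T\<close> periods between them, so that a single
    factor \<open>T\<close> arises.\<close>
  have flow: "time (flow_sums I es) + time (flow_sums I js) \<le> 100 * X\<^sup>2 + 2"
  proof -
    have "time (flow_sums I es) \<le> length es * (100 * N\<^sup>2) + 1" "time (flow_sums I js) \<le> length js * (100 * N\<^sup>2) + 1"
      unfolding N_def using I ij by (intro time_flow_sums; simp)+
    then have "time (flow_sums I es) + time (flow_sums I js) \<le> (length es + length js) * (100 * N\<^sup>2) + 2"
      by (simp add: algebra_simps)
    then show ?thesis using TX(3) ij(7) by simp
  qed
  have prod: "time (product_timed (\<lambda>k p. step (k + p)) ks ps) +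
      time (product_timed (\<lambda>k p. step (k - p)) ls qs) \<le> 18 * X + 4"
  proof -
    have "time (product_timed (\<lambda>k p. step (k + p)) ks ps) \<le> length ks * (3 * length ps + 3) + 2"
      "time (product_timed (\<lambda>k p. step (k - p)) ls qs) \<le> length ls * (3 * length qs + 3) + 2"
      by (intro time_product_timed; simp)+
    moreover have "length ks * (3 * length ps + 3) \<le> length ks * (6 * N)"
      "length ls * (3 * length qs + 3) \<le> length ls * (6 * N)"
      using len(1,2) pos by (intro mult_left_mono; simp)+
    ultimately have "time (product_timed (\<lambda>k p. step (k + p)) ks ps) +
      time (product_timed (\<lambda>k p. step (k - p)) ls qs) \<le> (length ks + length ls) * (6 * N) + 4"
      by (simp add: algebra_simps)
    also have "\<dots> \<le> (3 * ?T) * (6 * N) + 4"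
      by (rule add_right_mono, rule mult_right_mono[OF kl]) simp
    finally show ?thesis by (simp add: X)
  qed
  have rem: "time (remdups_timed cs) \<le> 18 * X\<^sup>2 + 6 * X + 1"
  proof -
    have "time (remdups_timed cs) \<le> 3 * X * (2 * (3 * X) + 2) + 1"
      using time_remdups_timed[OF cs] cs by (meson order_trans add_le_mono1 mult_le_mono1)
    then show ?thesis by (simp add: power2_eq_square algebra_simps)
  qed
  have es_js: "length es = t" "length js = ?T - t" by (simp_all add: es_def js_def del: upt_Suc)
  have time: "time (make_layer I t) = (2 * length es + 1) + (length es + 1) + time (flow_sums I es)
      + time (product_timed (\<lambda>k p. step (k + p)) ks ps) + 2 + (2 * length js + 1) + (length js + 1)
      + time (flow_sums I js) + time (product_timed (\<lambda>k p. step (k - p)) ls qs)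
      + (length as + 1) + (3 * length (as @ bs) + 1) + time (remdups_timed cs)"
    unfolding es_js
    by (simp add: make_layer_def cs_def as_def bs_def ps_def qs_def ks_def ls_def es_def js_def del: upt_Suc)
  have "length as \<le> length (as @ bs)" by simp
  then have "time (make_layer I t) \<le>
      3 * ?T + 14 + 100 * X\<^sup>2 + 18 * X + 4 * (3 * X) + 18 * X\<^sup>2 + 6 * X + 1"
    unfolding time using flow prod rem ab ij(7) by linarith
  also have "\<dots> \<le> 400 * X\<^sup>2" using XX TX(1) by linarith
  finally show "time (make_layer I t) \<le> 400 * X\<^sup>2" .
qed

text \<open>Building \<open>T\<close> layers and running the graph phase on layers of size at most
  \<open>5 * X\<close> both take order T X^2 steps, with 2900 = 400 + 100 * 25.\<close>

lemma time_solve_wp: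
  assumes I: "wp_instance I" and D: "integral_data I D M"
  shows "time (solve_wp I) \<le> 100000 * (horizon I + M) ^ 9"
proof -
  let ?T = "horizon I"
  define X where "X = ?T * (2 * ?T * M + 1)"
  define B where "B = ?T + M"
  let ?ts = "[1..<1 + ?T]"
  let ?Vs = "map (\<lambda>t. result (make_layer I t)) ?ts"
  have T: "1 \<le> ?T" using I by (simp add: wp_instance_def)
  have X: "1 \<le> X" "?T \<le> X" using T by (simp_all add: X_def)
  have ts: "set ?ts = {1..?T}" by auto
  have "time (map_timed (make_layer I) ?ts) \<le> length ?ts * (400 * X\<^sup>2 + 1) + 1"
    by (rule time_map_timed) (use make_layer_bounds(1)[OF D] ts in \<open>auto simp: X_def\<close>)
  moreover have "time (algorithm1 I ?Vs) \<le> 100 * length ?Vs * (5 * X)\<^sup>2"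
  proof (rule time_algorithm1)
    show "length V \<le> 5 * X" if V: "V \<in> set ?Vs" for V
    proof -
      obtain t where "t \<in> set ?ts" "V = result (make_layer I t)"
        using V by (auto simp del: upt_Suc set_upt)
      then show ?thesis unfolding ts using make_layer_bounds(2)[OF D] by (simp add: X_def)
    qed
    show "nonneg_bounds I (1 + i)" if "i < length ?Vs" for i
      using that by (intro wp_instance_nonneg_bounds[OF I]) (simp del: upt_Suc)
  qed (use T X in \<open>auto simp del: upt_Suc\<close>)
  moreover have "time (solve_wp I) = (2 * ?T + 1) + time (map_timed (make_layer I) ?ts) + time (algorithm1 I ?Vs)"
    by (simp add: solve_wp_def del: upt_Suc)
  ultimately have "time (solve_wp I) \<le> 2 * ?T + 1 + (?T * (400 * X\<^sup>2 + 1) + 1) + 100 * ?T * (5 * X)\<^sup>2"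
    by (simp del: upt_Suc)
  also have "\<dots> = 2900 * (?T * X\<^sup>2) + 3 * ?T + 2"
    by (simp add: power_mult_distrib algebra_simps)
  also have "\<dots> \<le> 3000 * X ^ 3"
  proof -
    have "?T * X\<^sup>2 \<le> X * X\<^sup>2" using X(2) by (rule mult_right_mono) simp
    then have "?T * X\<^sup>2 \<le> X ^ 3" by (simp add: power2_eq_square power3_eq_cube)
    moreover have "X \<le> X ^ 3" "1 \<le> X ^ 3" using X(1) by (simp_all add: self_le_power)
    ultimately show ?thesis using X(2) by linarith
  qed
  also have "\<dots> \<le> 3000 * (3 * B ^ 3) ^ 3"
  proof -
    have "1 \<le> B" using T by (simp add: B_def)
    have "?T * M \<le> B * B" by (intro mult_mono) (auto simp: B_def)
    moreover have "1 \<le> B * B" using \<open>1 \<le> B\<close> by simp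
    ultimately have "2 * ?T * M + 1 \<le> 3 * (B * B)" by linarith
    then have "X \<le> B * (3 * (B * B))" unfolding X_def by (intro mult_mono) (auto simp: B_def)
    then have "X \<le> 3 * B ^ 3" by (simp add: power3_eq_cube)
    then show ?thesis by (intro mult_left_mono power_mono) auto
  qed
  also have "\<dots> = 81000 * B ^ 9" by (simp add: power_mult_distrib flip: power_mult)
  also have "\<dots> \<le> 100000 * B ^ 9" by simp
  finally show ?thesis by (simp add: B_def)
qed

section \<open>Common denominators of rational data\<close>

lemma finite_data: "finite (data I)"
  by (simp add: data_def)

text \<open>The product of the individual denominators works. Existence is what gives the
  \<open>LEAST\<close> in \<open>common_denominator\<close> its meaning.\<close>

lemma ex_common_denominator:
  assumes "finite A" "A \<subseteq> \<rat>"
  shows "\<exists>d::nat. 0 < d \<and> (\<forall>r\<in>A. real d * r \<in> \<int>)"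
  using assms
proof (induction rule: finite_induct)
  case empty
  show ?case by (intro exI[of _ 1]) simp
next
  case (insert r A)
  then obtain d where d: "0 < d" "\<forall>r\<in>A. real d * r \<in> \<int>" by auto
  obtain a b :: int where ab: "b > 0" "r = of_int a / of_int b"
    using insert.prems by (auto elim: Rats_cases')
  have b: "real (nat b) = of_int b" using ab(1) by simp
  have "real (d * nat b) * r' \<in> \<int>" if "r' \<in> insert r A" for r'
  proof (cases "r' = r")
    case True
    then have "real (d * nat b) * r' = of_int (int d * a)" using ab by (simp add: b)
    then show ?thesis by (metis Ints_of_int)
  next
    case False
    then have "real d * r' \<in> \<int>" using d that by auto
    then have "of_int b * (real d * r') \<in> \<int>" by (rule Ints_mult[OF Ints_of_int])
    moreover have "real (d * nat b) * r' = of_int b * (real d * r')" by (simp add: b)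
    ultimately show ?thesis by (simp only:)
  qed
  then show ?case using d(1) ab(1) by (intro exI[of _ "d * nat b"]) simp
qed

text \<open>The maximum over the finite data is attained, so it is a nonnegative integer and can be
  read as a natural number \<open>M\<close>.\<close>

lemma integral_data_common_denominator:
  assumes "data I \<subseteq> \<rat>"
  obtains M where "real M = max_number I" "integral_data I (common_denominator I) M"
proof -
  let ?D = "common_denominator I"
  have D: "0 < ?D" "\<And>r. r \<in> data I \<Longrightarrow> real ?D * r \<in> \<int>"
    using LeastI_ex[OF ex_common_denominator[OF finite_data assms]]
    unfolding common_denominator_def by blast+
  let ?A = "(\<lambda>r. \<bar>real ?D * r\<bar>) ` data I"
  have A: "finite ?A" "?A \<noteq> {}" using finite_data by (auto simp: data_def)
  have "max_number I \<in> ?A" unfolding max_number_def using A by (rule Max_in)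
  then have "max_number I \<in> \<int>" "0 \<le> max_number I" using D(2) by auto
  then obtain M where M: "real M = max_number I"
    by (metis Ints_cases of_int_0_le_iff of_int_of_nat_eq zero_le_imp_eq_int)
  have "\<exists>k::int. real ?D * r = of_int k \<and> \<bar>k\<bar> \<le> int M" if r: "r \<in> data I" for r
  proof -
    obtain k :: int where k: "real ?D * r = of_int k" using D(2)[OF r] by (auto elim: Ints_cases)
    have "\<bar>real ?D * r\<bar> \<le> real M" unfolding M max_number_def using A(1) r by (intro Max_ge) auto
    then have "\<bar>k\<bar> \<le> int M" unfolding k by linarith
    then show ?thesis using k by blast
  qed
  then show ?thesis using that M D(1) by (auto simp: integral_data_def)
qed

theorem theorem3:
  shows "(\<exists>C::nat. \<forall>I Vs. wp_instance I \<longrightarrow> node_layers I Vs \<longrightarrow>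
            solves I (result (algorithm1 I Vs)) \<and>
            time (algorithm1 I Vs) \<le> C * horizon I * (max 1 (max_stock_card I))\<^sup>2)
       \<and> (\<exists>(C::nat) (k::nat). \<forall>I. wp_instance I \<longrightarrow> data I \<subseteq> \<rat> \<longrightarrow>
            solves I (result (solve_wp I)) \<and>
            real (time (solve_wp I)) \<le> real C * (real (horizon I) + max_number I) ^ k)"
proof (rule conjI)
  show "\<exists>C::nat. \<forall>I Vs. wp_instance I \<longrightarrow> node_layers I Vs \<longrightarrow>
            solves I (result (algorithm1 I Vs)) \<and>
            time (algorithm1 I Vs) \<le> C * horizon I * (max 1 (max_stock_card I))\<^sup>2"
    using algorithm1_solves algorithm1_time by blast
  have "solves I (result (solve_wp I)) \<and>
      real (time (solve_wp I)) \<le> real 100000 * (real (horizon I) + max_number I) ^ 9"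
    if I: "wp_instance I" and rat: "data I \<subseteq> \<rat>" for I
  proof
    show "solves I (result (solve_wp I))"
      using algorithm1_solves[OF I node_layers_make_layer] by (simp add: solve_wp_def del: upt_Suc)
    obtain M where M: "real M = max_number I" "integral_data I (common_denominator I) M"
      using integral_data_common_denominator[OF rat] by blast
    have "real (time (solve_wp I)) \<le> real (100000 * (horizon I + M) ^ 9)"
      using time_solve_wp[OF I M(2)] by (simp only: of_nat_le_iff)
    then show "real (time (solve_wp I)) \<le> real 100000 * (real (horizon I) + max_number I) ^ 9"
      by (simp add: M(1))
  qed
  then show "\<exists>(C::nat) (k::nat). \<forall>I. wp_instance I \<longrightarrow> data I \<subseteq> \<rat> \<longrightarrow>
            solves I (result (solve_wp I)) \<and>
            real (time (solve_wp I)) \<le> real C * (real (horizon I) + max_number I) ^ k"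
    by blast
qed

end
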